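(* Let $G$ be a finite group, and let $A$ and $B$ be supersoluble subgroups of $G$ such that $G=AB$ is the mutually permutable product of $A$ and $B$. Then $G^{\mathfrak U}=(G^\prime)^{\mathfrak N}=[A,B]^{\mathfrak N}$.
   Context: All groups are finite. A group $G=AB$ is called the mutually permutable product of subgroups $A$ and $B$ if $UB=BU$ for every subgroup $U\le A$ and $AV=VA$ for every subgroup $V\le B$. For a formation $\mathfrak F$ and a group $X$, $X^{\mathfrak F}$ denotes the $\mathfrak F$-residual of $X$, i.e. the smallest normal subgroup of $X$ with quotient in $\mathfrak F$. $\mathfrak N$ is the formation of all (finite) nilpotent groups and $\mathfrak U$ is the formation of all (finite) supersoluble groups. $G^\prime$ is the derived subgroup of $G$, and $[A,B]=\langle [a,b]\mid a\in A,\ b\in B\rangle$ is the subgroup generated by all commutators of elements of $A$ with elements of $B$. *)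

theory Defs
  imports "HOL-Algebra.Algebra"
begin

text \<open>
  Commutators follow the convention of \<^const>\<open>derived\<close>, namely
  \<open>h k h\<inverse> k\<inverse>\<close>. When \<open>H\<close> and \<open>K\<close> are subgroups, the convention
  \<open>h\<inverse> k\<inverse> h k\<close> gives the same set of commutators.
\<close>

definition commutator_subgroup :: "('a, 'b) monoid_scheme \<Rightarrow> 'a set \<Rightarrow> 'a set \<Rightarrow> 'a set" where
  "commutator_subgroup G H K =
     generate G {h \<otimes>\<^bsub>G\<^esub> k \<otimes>\<^bsub>G\<^esub> inv\<^bsub>G\<^esub> h \<otimes>\<^bsub>G\<^esub> inv\<^bsub>G\<^esub> k | h k. h \<in> H \<and> k \<in> K}"

lemma commutator_subgroup_self: "commutator_subgroup G H H = derived G H"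
  unfolding commutator_subgroup_def derived_def by (rule arg_cong[where f = "generate G"]) blast

primrec lower_central :: "('a, 'b) monoid_scheme \<Rightarrow> nat \<Rightarrow> 'a set" where
  "lower_central G 0 = carrier G"
| "lower_central G (Suc n) = commutator_subgroup G (lower_central G n) (carrier G)"

definition nilpotent_group :: "('a, 'b) monoid_scheme \<Rightarrow> bool" where
  "nilpotent_group G \<longleftrightarrow> group G \<and> (\<exists>n. lower_central G n = {\<one>\<^bsub>G\<^esub>})"

text \<open>
  Every term of the series is normal in the whole group \<open>G\<close>, not just in the next term.
\<close>

definition supersoluble_group :: "('a, 'b) monoid_scheme \<Rightarrow> bool" where
  "supersoluble_group G \<longleftrightarrow> group G \<and>
     (\<exists>(S :: nat \<Rightarrow> 'a set) n. S 0 = {\<one>\<^bsub>G\<^esub>} \<and> S n = carrier G \<and>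
        (\<forall>i\<le>n. S i \<lhd> G) \<and>
        (\<forall>i<n. S i \<subseteq> S (Suc i) \<and> cyclic_group ((G\<lparr>carrier := S (Suc i)\<rparr>) Mod S i)))"

text \<open>
  The order on sets is inclusion, so \<open>LEAST\<close> picks the smallest normal subgroup of \<open>G\<close> whose
  quotient satisfies \<open>F\<close>. It exists whenever \<open>G\<close> is a finite group and \<open>F\<close> is a formation,
  in particular for the nilpotent and for the supersoluble groups. Quotients of a group over
  \<open>'a\<close> have elements of type \<open>'a set\<close>, hence the type of \<open>F\<close>.
\<close>

definition residual :: "('a set monoid \<Rightarrow> bool) \<Rightarrow> ('a, 'b) monoid_scheme \<Rightarrow> 'a set" where
  "residual F G = (LEAST N. N \<lhd> G \<and> F (G Mod N))"

definition mutually_permutable_product ::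
    "('a, 'b) monoid_scheme \<Rightarrow> 'a set \<Rightarrow> 'a set \<Rightarrow> bool" where
  "mutually_permutable_product G A B \<longleftrightarrow>
     subgroup A G \<and> subgroup B G \<and> carrier G = A <#>\<^bsub>G\<^esub> B \<and>
     (\<forall>U. subgroup U G \<and> U \<subseteq> A \<longrightarrow> U <#>\<^bsub>G\<^esub> B = B <#>\<^bsub>G\<^esub> U) \<and>
     (\<forall>V. subgroup V G \<and> V \<subseteq> B \<longrightarrow> A <#>\<^bsub>G\<^esub> V = V <#>\<^bsub>G\<^esub> A)"

end

theory Submission
  imports Defs
begin

text \<open>
  All three residuals are shown to equal \<open>R\<close>, the term at which the lower central series of
  \<open>K = [A,B]\<close> becomes stationary. Both \<open>K\<close> and \<open>R\<close> are normal in \<open>G\<close>. It is enough to know two things: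

  \<^item> \<open>G / R\<close> is supersoluble (\<open>supersoluble_Mod_of_nilpotent_commutator\<close>);
  \<^item> if \<open>G / N\<close> is supersoluble, then some term of the lower central series of \<open>G'\<close> lies in
    \<open>N\<close> (\<open>supersoluble_Mod_imp_lower_central_derived_subset\<close>), since \<open>G'\<close> centralizes every
    cyclic factor of a normal series.

  As \<open>K \<subseteq> G'\<close>, these give \<open>R \<subseteq> (G')\<^sup>\<NN> \<subseteq> N\<close> for every such \<open>N\<close>, where \<open>(G')\<^sup>\<NN>\<close> is the nilpotent
  residual of \<open>G'\<close>. Taking \<open>N = R\<close> shows \<open>(G')\<^sup>\<NN> = R\<close>, and \<open>R\<close> is the least \<open>N\<close>.

  For the first point, a normal series from \<open>R\<close> up to \<open>G\<close> is built so that the orders of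
  successive terms have prime ratio. Let \<open>M \<supseteq> R\<close> be a proper normal subgroup of \<open>G\<close>. The chain
  \<open>M T\<^sub>0 \<subseteq> \<dots> \<subseteq> M T\<^sub>r = M A = M A S\<^sub>0 \<subseteq> \<dots> \<subseteq> M A S\<^sub>t = G\<close>, where the \<open>T\<^sub>i\<close> and the \<open>S\<^sub>j\<close> run
  through normal series of \<open>A\<close> and of \<open>B\<close> with prime indices, consists of subgroups, because \<open>A\<close>
  permutes with each \<open>S\<^sub>j\<close>. All of them are normalized by \<open>A\<close>, and each has index one or a prime in
  the next (\<open>prime_chain_of_factorization\<close>). Intersecting with a normal subgroup \<open>N\<close> that properly
  contains \<open>M\<close> yields a subgroup \<open>L\<close> with \<open>M \<subseteq> L \<subseteq> N\<close> and \<open>|L : M|\<close> prime that \<open>A\<close> normalizes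
  (\<open>prime_chain_meets\<close>). By symmetry the same holds for \<open>B\<close>.

  If \<open>K \<subseteq> M\<close>, then \<open>A\<close> and \<open>B\<close> commute modulo \<open>M\<close>, and for a suitable choice of \<open>N\<close> the
  subgroup \<open>L\<close>, or its analogue for \<open>B\<close>, is normal in \<open>G\<close> (\<open>prime_step_of_central_product\<close>).
  Otherwise let \<open>N = M C\<close>, where \<open>C\<close> is the last term of the lower central series of \<open>K\<close> that is
  not contained in \<open>M\<close>. Then \<open>N / M\<close> is abelian and centralized by \<open>K\<close>. Each \<open>a \<in> A\<close> acts on the
  cyclic group \<open>L / M\<close> as a power map with exponent \<open>l a\<close>. The elements of \<open>N\<close> on which, modulo
  \<open>M\<close>, every \<open>a\<close> acts as the power map with exponent \<open>l a\<close> form a subgroup \<open>W\<close> containing \<open>L\<close>,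
  and \<open>W\<close> is normal in \<open>G\<close>, because \<open>A\<close> and \<open>B\<close> commute in their action on \<open>N / M\<close>. A subgroup
  \<open>P \<subseteq> W\<close> with \<open>|P : M|\<close> prime that \<open>B\<close> normalizes is then normalized by \<open>A\<close> as well, hence normal
  in \<open>G\<close> (\<open>prime_step_of_centralized_factor\<close>).
\<close>

section \<open>Quotient maps and orders of products\<close>

lemma (in group) inv_cancel_left:
  "\<lbrakk>x \<in> carrier G; w \<in> carrier G\<rbrakk> \<Longrightarrow> inv x \<otimes> (x \<otimes> w) = w"
  by (simp add: m_assoc[symmetric])

lemma (in group) r_coset_eq_iff:
  assumes N: "subgroup N G" and x: "x \<in> carrier G" and y: "y \<in> carrier G"
  shows "N #> x = N #> y \<longleftrightarrow> x \<otimes> inv y \<in> N"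
proof
  interpret N: subgroup N G by fact
  {
    assume "N #> x = N #> y"
    then have "x \<in> N #> y" using rcos_self[OF x N] by simp
    then show "x \<otimes> inv y \<in> N"
      using x y N.subset by (auto simp: r_coset_def inv_solve_right' m_assoc subset_iff)
  next
    assume "x \<otimes> inv y \<in> N"
    then have "x \<in> N #> y"
      unfolding r_coset_def using x y by (auto intro!: bexI[of _ "x \<otimes> inv y"] simp: m_assoc)
    then show "N #> x = N #> y" using repr_independence[OF _ y N] by simp
  }
qed

text \<open>
  The quotient map modulo \<open>N\<close>, described only by which elements it identifies: that its target
  consists of cosets plays no role when computing modulo \<open>N\<close>.
\<close>
lemma (in group) quotient_map:
  assumes "N \<lhd> G"
  obtains H :: "'a set monoid" and h
  where "group_hom G H h"
    and "\<And>x y. \<lbrakk>x \<in> carrier G; y \<in> carrier G\<rbrakk> \<Longrightarrow> h x = h y \<longleftrightarrow> x \<otimes> inv y \<in> N"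
proof -
  interpret N: normal N G by fact
  interpret Q: group "G Mod N" by (rule N.factorgroup_is_group)
  have "group_hom G (G Mod N) (\<lambda>a. N #> a)"
    by unfold_locales (rule N.r_coset_hom_Mod)
  then show ?thesis using r_coset_eq_iff[OF N.subgroup_axioms] by (rule that)
qed

lemma set_mult_memI: "\<lbrakk>h \<in> H; k \<in> K; x = h \<otimes>\<^bsub>G\<^esub> k\<rbrakk> \<Longrightarrow> x \<in> H <#>\<^bsub>G\<^esub> K"
  by (auto simp: set_mult_def)

lemma (in group) card_subgroup_dvd:
  assumes "subgroup H G" "subgroup K G" "H \<subseteq> K"
  shows "card H dvd card K"
proof -
  interpret K: group "G\<lparr>carrier := K\<rparr>"
    using assms(2) by (rule subgroup_imp_group)
  show ?thesis
    using K.lagrange[OF subgroup_incl[OF assms]]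
    by (simp add: order_def) (metis dvd_triv_right)
qed

lemma (in group) card_set_mult:
  assumes H: "subgroup H G" and K: "subgroup K G"
  shows "card (H <#> K) * card (H \<inter> K) = card H * card K"
proof -
  interpret H: subgroup H G by fact
  interpret K: subgroup K G by fact
  have "\<forall>z \<in> H <#> K. \<exists>a b. a \<in> H \<and> b \<in> K \<and> z = a \<otimes> b"
    by (auto simp: set_mult_def)
  then obtain a b where ab: "\<And>z. z \<in> H <#> K \<Longrightarrow> a z \<in> H \<and> b z \<in> K \<and> z = a z \<otimes> b z"
    by metis
  have abc: "a z \<in> carrier G \<and> b z \<in> carrier G" if "z \<in> H <#> K" for z
    using ab[OF that] by auto
  \<comment> \<open>The fibre of the multiplication map over \<open>z = a b\<close> consists of the pairs
      \<open>(a d, d\<inverse> b)\<close> with \<open>d \<in> H \<inter> K\<close>.\<close>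
  define f where "f = (\<lambda>(z, d). (a z \<otimes> d, inv d \<otimes> b z))"
  have "bij_betw f ((H <#> K) \<times> (H \<inter> K)) (H \<times> K)"
  proof (rule bij_betwI')
    fix u v assume u: "u \<in> (H <#> K) \<times> (H \<inter> K)" and v: "v \<in> (H <#> K) \<times> (H \<inter> K)"
    obtain z d where u': "u = (z, d)" by force
    obtain z' d' where v': "v = (z', d')" by force
    have z: "z \<in> H <#> K" "d \<in> H" "d \<in> K" "z' \<in> H <#> K" "d' \<in> H" "d' \<in> K"
      using u v u' v' by auto
    have c: "d \<in> carrier G" "d' \<in> carrier G" using z by auto
    show "f u = f v \<longleftrightarrow> u = v"
    proof
      assume eq: "f u = f v"
      have p: "(a y \<otimes> e) \<otimes> (inv e \<otimes> b y) = y"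
        if "y \<in> H <#> K" "e \<in> carrier G" for y e
      proof -
        have "(a y \<otimes> e) \<otimes> (inv e \<otimes> b y) = a y \<otimes> b y"
          using abc[OF that(1)] that(2) by (metis inv_closed m_assoc r_inv m_closed l_one)
        then show ?thesis using ab[OF that(1)] by simp
      qed
      have zz: "z = z'"
        using p[OF z(1) c(1)] p[OF z(4) c(2)] eq unfolding f_def u' v' by simp
      moreover have "d = d'"
        using eq abc[OF z(1)] c unfolding f_def u' v' zz by simp
      ultimately show "u = v" by (simp add: u' v')
    qed simp
  next
    fix u assume "u \<in> (H <#> K) \<times> (H \<inter> K)"
    then show "f u \<in> H \<times> K"
      using ab by (auto simp: f_def)
  next
    fix w assume "w \<in> H \<times> K"
    then obtain x y where w: "w = (x, y)" "x \<in> H" "y \<in> K" by force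
    define z where "z = x \<otimes> y"
    have z: "z \<in> H <#> K" using w by (auto simp: z_def set_mult_def)
    have Z: "a z \<in> H" "b z \<in> K" "a z \<in> carrier G" "b z \<in> carrier G"
      using ab[OF z] abc[OF z] by auto
    have prod: "x \<otimes> y = a z \<otimes> b z" using ab[OF z] by (simp add: z_def)
    define d where "d = inv (a z) \<otimes> x"
    have xy: "x \<in> carrier G" "y \<in> carrier G" using w by auto
    have dc: "d \<in> carrier G" using Z xy by (simp add: d_def)
    have ad: "a z \<otimes> d = x" using Z xy by (simp add: d_def m_assoc[symmetric])
    have "x \<otimes> y = x \<otimes> (inv d \<otimes> b z)"
    proof -
      have "x \<otimes> (inv d \<otimes> b z) = (x \<otimes> inv d) \<otimes> b z" using xy dc Z by (simp add: m_assoc)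
      also have "x \<otimes> inv d = a z" using ad dc Z xy by (metis inv_solve_right')
      finally show ?thesis using prod by simp
    qed
    then have db: "inv d \<otimes> b z = y" using xy dc Z by simp
    then have "d \<otimes> y = b z" using xy dc Z by (simp add: db[symmetric] m_assoc[symmetric])
    then have "d = b z \<otimes> inv y" using xy dc Z by (metis inv_solve_right)
    then have "d \<in> K" using Z w by simp
    moreover have "d \<in> H" using Z w by (simp add: d_def)
    ultimately have "d \<in> H \<inter> K" by simp
    then show "\<exists>u \<in> (H <#> K) \<times> (H \<inter> K). w = f u"
      using z ad db w by (intro bexI[of _ "(z, d)"]) (auto simp: f_def)
  qed
  then have "card ((H <#> K) \<times> (H \<inter> K)) = card (H \<times> K)" by (rule bij_betw_same_card)
  then show ?thesis by (simp add: card_cartesian_product)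
qed

text \<open>
  Let \<open>|S : T| = p\<close>. Multiplying a subgroup \<open>P \<supseteq> T\<close> by \<open>S\<close> multiplies its order by 1 or by \<open>p\<close>,
  because \<open>P \<inter> S\<close> lies between \<open>T\<close> and \<open>S\<close>. The set \<open>P S\<close> need not be a subgroup.
\<close>
lemma (in group) card_set_mult_prime:
  assumes fin: "finite (carrier G)"
    and P: "subgroup P G" and S: "subgroup S G" and T: "subgroup T G"
    and "T \<subseteq> S" "T \<subseteq> P" "Factorial_Ring.prime p" "card S = p * card T"
  shows "card (P <#> S) = card P \<or> card (P <#> S) = p * card P"
proof -
  have PS: "subgroup (P \<inter> S) G" using P S by (rule subgroups_Inter_pair)
  have pos: "card V > 0" if "subgroup V G" for V
    using that fin by (metis card_gt_0_iff finite_subset subgroup.subset subgroup.one_closed empty_iff)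
  obtain c where c: "card (P \<inter> S) = card T * c"
    using card_subgroup_dvd[OF T PS] \<open>T \<subseteq> S\<close> \<open>T \<subseteq> P\<close> by (auto simp: dvd_def)
  have "card T * c dvd card T * p"
    using card_subgroup_dvd[OF PS S] c \<open>card S = p * card T\<close> by (simp add: mult.commute)
  then have "c dvd p" using pos[OF T] by simp
  then have "c = 1 \<or> c = p" using \<open>Factorial_Ring.prime p\<close> by (auto simp: prime_nat_iff)
  moreover have "card (P <#> S) * (card T * c) = card P * (p * card T)"
    using card_set_mult[OF P S] c \<open>card S = p * card T\<close> by simp
  then have "card (P <#> S) * c = card P * p" using pos[OF T] by (simp add: ac_simps)
  ultimately show ?thesis using prime_gt_0_nat[OF \<open>Factorial_Ring.prime p\<close>] by fastforce
qed

section \<open>Chains of subgroups with prime indices\<close>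

text \<open>
  \<open>prime_chain G A M V\<close> says that \<open>V\<close> is reached from \<open>M\<close> by a finite chain of subgroups of \<open>G\<close>,
  each normalized by \<open>A\<close> and of prime index in the next (the start \<open>M\<close> itself carries no
  condition). The index is expressed through cardinalities, which is adequate for finite groups.
  For \<open>A = carrier G\<close> and \<open>M\<close> normal this is a normal series of \<open>G\<close>.
\<close>
inductive prime_chain :: "('a, 'b) monoid_scheme \<Rightarrow> 'a set \<Rightarrow> 'a set \<Rightarrow> 'a set \<Rightarrow> bool"
  for G A M where
  start: "prime_chain G A M M"
| step: "\<lbrakk>prime_chain G A M V; subgroup Y G; V \<subseteq> Y; Factorial_Ring.prime p; card Y = p * card V;
     \<And>a y. \<lbrakk>a \<in> A; y \<in> Y\<rbrakk> \<Longrightarrow> a \<otimes>\<^bsub>G\<^esub> y \<otimes>\<^bsub>G\<^esub> inv\<^bsub>G\<^esub> a \<in> Y\<rbrakk> \<Longrightarrow> prime_chain G A M Y"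

lemma prime_chain_subgroup:
  assumes "prime_chain G A M V" "subgroup M G"
  shows "subgroup V G \<and> M \<subseteq> V"
  using assms by induction auto

lemma (in group) prime_chain_weak_step:
  assumes "prime_chain G A M V" "finite (carrier G)"
    and Y: "subgroup Y G" "V \<subseteq> Y" "Factorial_Ring.prime p" "card Y = card V \<or> card Y = p * card V"
    and "\<And>a y. \<lbrakk>a \<in> A; y \<in> Y\<rbrakk> \<Longrightarrow> a \<otimes> y \<otimes> inv a \<in> Y"
  shows "prime_chain G A M Y"
  using Y(4)
proof
  assume "card Y = card V"
  then have "V = Y"
    using Y(1,2) assms(2) by (metis card_subset_eq finite_subset subgroup.subset)
  then show ?thesis using assms(1) by simp
next
  assume "card Y = p * card V"
  then show ?thesis using assms prime_chain.step by blast
qed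

text \<open>
  At the first member \<open>Y\<close> of the chain whose intersection with \<open>N\<close> exceeds \<open>M\<close>, with
  predecessor \<open>V\<close>, the product of \<open>N \<inter> Y\<close> and \<open>V\<close> is a subgroup strictly above \<open>V\<close>, hence all
  of \<open>Y\<close>. The product formula gives \<open>|N \<inter> Y : M| = |Y : V|\<close>, which is prime.
\<close>
lemma (in group) prime_chain_meets:
  assumes "prime_chain G A M V" "finite (carrier G)" and M: "M \<lhd> G" and N: "N \<lhd> G" and "M \<subseteq> N"
    and A: "A \<subseteq> carrier G" and "N \<inter> V \<noteq> M"
  shows "\<exists>L p. subgroup L G \<and> M \<subseteq> L \<and> L \<subseteq> N \<and> Factorial_Ring.prime p \<and> card L = p * card M
           \<and> (\<forall>a\<in>A. \<forall>y\<in>L. a \<otimes> y \<otimes> inv a \<in> L)"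
  using assms(1,7)
proof induction
  case start
  then show ?case using \<open>M \<subseteq> N\<close> by blast
next
  case (step V Y p)
  show ?case
  proof (cases "N \<inter> V = M")
    case False
    then show ?thesis using step by blast
  next
    case True
    interpret M: normal M G by fact
    interpret N: normal N G by fact
    define L where "L = N \<inter> Y"
    have V: "subgroup V G" "M \<subseteq> V"
      using prime_chain_subgroup[OF step.hyps(1) M.subgroup_axioms] by auto
    have L: "subgroup L G"
      unfolding L_def using N.subgroup_axioms step.hyps(2) by (rule subgroups_Inter_pair)
    interpret V: subgroup V G by fact
    interpret Y: subgroup Y G by fact
    have MsubL: "M \<subseteq> L" using V step \<open>M \<subseteq> N\<close> by (auto simp: L_def)
    have conj: "\<forall>a\<in>A. \<forall>y\<in>L. a \<otimes> y \<otimes> inv a \<in> L"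
      using step.hyps(6) A N.inv_op_closed2 by (auto simp: L_def)
    have LY: "L \<lhd> G\<lparr>carrier := Y\<rparr>"
    proof -
      interpret GY: group "G\<lparr>carrier := Y\<rparr>" by (rule subgroup_imp_group[OF step.hyps(2)])
      show ?thesis
        by (rule GY.normal_invI)
          (auto simp: L_def subgroup_incl[OF L step.hyps(2), unfolded L_def] N.inv_op_closed2
             step.hyps(2))
    qed
    have XL: "subgroup (L <#> V) G"
    proof -
      interpret GY: group "G\<lparr>carrier := Y\<rparr>" by (rule subgroup_imp_group[OF step.hyps(2)])
      show ?thesis
        using GY.mult_norm_subgroup[OF LY subgroup_incl[OF V(1) step.hyps(2,3)]]
          incl_subgroup[OF step.hyps(2)] by simp
    qed
    have "v \<in> L <#> V" if "v \<in> V" for v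
      by (rule set_mult_memI[OF subgroup.one_closed[OF L] that]) (use that in simp)
    moreover have "v \<in> L <#> V" if "v \<in> L" for v
      by (rule set_mult_memI[OF that V.one_closed]) (use subgroup.mem_carrier[OF L that] in simp)
    moreover have "L <#> V \<subseteq> Y" using step.hyps(3) by (auto simp: set_mult_def L_def)
    ultimately have sub: "V \<subseteq> L <#> V" "L \<subseteq> L <#> V" "L <#> V \<subseteq> Y" by blast+
    have fin: "finite S" if "subgroup S G" for S
      using that assms(2) by (meson finite_subset subgroup.subset)
    have pos: "card S > 0" if "subgroup S G" for S
      using that fin[OF that] subgroup.one_closed card_gt_0_iff by blast
    obtain c where c: "card (L <#> V) = card V * c"
      using card_subgroup_dvd[OF V(1) XL] sub by (metis dvdE)
    have "card V * c dvd card V * p"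
      using card_subgroup_dvd[OF XL step.hyps(2)] c sub step.hyps(5) by (simp add: mult.commute)
    then have "c dvd p" using pos[OF V(1)] by simp
    moreover have "c \<noteq> 1"
    proof
      assume "c = 1"
      then have "V = L <#> V" using c sub fin[OF XL] by (simp add: card_subset_eq)
      then have "L \<subseteq> V" using sub by simp
      then show False using step.prems True MsubL by (auto simp: L_def)
    qed
    ultimately have "c = p" using \<open>Factorial_Ring.prime p\<close> by (auto simp: prime_nat_iff)
    moreover have "L \<inter> V = M" using True step.hyps(3) by (auto simp: L_def)
    ultimately have "(card V * p) * card M = card L * card V"
      using card_set_mult[OF L V(1)] c by simp
    then have "card L = p * card M" using pos[OF V(1)] by (simp add: ac_simps)
    then show ?thesis using L MsubL conj \<open>Factorial_Ring.prime p\<close> by (intro exI[of _ L] exI[of _ p]) (auto simp: L_def)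
  qed
qed

section \<open>Cyclic factors\<close>

lemma (in group) int_pow_conj:
  assumes "g \<in> carrier G" "x \<in> carrier G"
  shows "(g \<otimes> x \<otimes> inv g) [^] (k::int) = g \<otimes> x [^] k \<otimes> inv g"
proof -
  have "group_hom G G (\<lambda>x. g \<otimes> x \<otimes> inv g)"
  proof unfold_locales
    show "(\<lambda>x. g \<otimes> x \<otimes> inv g) \<in> hom G G"
      using assms(1) by (auto simp: hom_def m_assoc inv_solve_left)
  qed
  then show ?thesis using group_hom.hom_int_pow[OF _ assms(2)] by fastforce
qed

text \<open>
  \<open>cyclic_over G U V\<close> says that a single element \<open>x\<close> generates \<open>V\<close> modulo \<open>U\<close>: each \<open>y \<in> V\<close> lies in
  the coset \<open>U x\<^sup>k\<close> for some integer \<open>k\<close>. For \<open>U\<close> normal in \<open>G\<close> and contained in \<open>V\<close> this means that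
  \<open>V / U\<close> is cyclic, but no quotient group has to be formed.
\<close>
definition cyclic_over :: "('a, 'b) monoid_scheme \<Rightarrow> 'a set \<Rightarrow> 'a set \<Rightarrow> bool" where
  "cyclic_over G U V \<longleftrightarrow>
     (\<exists>x\<in>V. \<forall>y\<in>V. \<exists>k::int. y \<otimes>\<^bsub>G\<^esub> inv\<^bsub>G\<^esub> (x [^]\<^bsub>G\<^esub> k) \<in> U)"

lemma (in group) cyclic_group_Mod_iff:
  assumes U: "U \<lhd> G" and V: "subgroup V G" and UV: "U \<subseteq> V"
  shows "cyclic_group ((G\<lparr>carrier := V\<rparr>) Mod U) \<longleftrightarrow> cyclic_over G U V"
proof -
  interpret U: normal U G by fact
  interpret V: subgroup V G by fact
  let ?W = "G\<lparr>carrier := V\<rparr>"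
  interpret W: group ?W by (rule subgroup_imp_group[OF V])
  have UW: "U \<lhd> ?W"
    by (rule W.normal_invI)
      (auto simp: subgroup_incl[OF U.subgroup_axioms V UV] U.inv_op_closed2 V)
  interpret UW: normal U ?W by fact
  interpret Q: group "?W Mod U" by (rule UW.factorgroup_is_group)
  have car: "carrier (?W Mod U) = (\<lambda>x. U #> x) ` V"
    by (simp add: carrier_FactGroup)
  have pw: "(U #> x) [^]\<^bsub>?W Mod U\<^esub> k = U #> (x [^] k)" if "x \<in> V" for x and k :: int
    using UW.FactGroup_int_pow[of x k] that int_pow_consistent[OF V that] by simp
  have eq: "U #> y = U #> z \<longleftrightarrow> y \<otimes> inv z \<in> U" if "y \<in> V" "z \<in> V" for y z
    using r_coset_eq_iff[OF U.subgroup_axioms] that by simp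
  have pV: "x [^] k \<in> V" if "x \<in> V" for x and k :: int
    using subgroup_int_pow_closed[OF V that] .
  have "cyclic_group (?W Mod U) \<longleftrightarrow>
      (\<exists>x\<in>V. (\<lambda>y. U #> y) ` V = range (\<lambda>k::int. U #> (x [^] k)))"
    by (auto simp: Q.cyclic_group car pw cong: bex_cong)
  also have "\<dots> \<longleftrightarrow> (\<exists>x\<in>V. \<forall>y\<in>V. \<exists>k::int. U #> y = U #> (x [^] k))"
  proof (intro bex_cong refl)
    fix x assume x: "x \<in> V"
    then have "range (\<lambda>k::int. U #> (x [^] k)) \<subseteq> (\<lambda>y. U #> y) ` V" using pV by blast
    then show "(\<lambda>y. U #> y) ` V = range (\<lambda>k::int. U #> (x [^] k))
        \<longleftrightarrow> (\<forall>y\<in>V. \<exists>k::int. U #> y = U #> (x [^] k))"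
      by (simp add: set_eq_subset image_subset_iff image_iff)
  qed
  also have "\<dots> \<longleftrightarrow> cyclic_over G U V"
    unfolding cyclic_over_def using pV eq by (simp cong: bex_cong ball_cong)
  finally show ?thesis .
qed

text \<open>An automorphism of a cyclic group is a power map; here for conjugation by \<open>g\<close> on \<open>V / U\<close>.\<close>
lemma (in group) cyclic_over_conj_pow:
  assumes U: "U \<lhd> G" and V: "subgroup V G" and cyc: "cyclic_over G U V"
    and g: "g \<in> carrier G" and norm: "\<And>y. y \<in> V \<Longrightarrow> g \<otimes> y \<otimes> inv g \<in> V"
  shows "\<exists>l::int. \<forall>y\<in>V. (g \<otimes> y \<otimes> inv g) \<otimes> inv (y [^] l) \<in> U"
proof -
  interpret V: subgroup V G by fact
  obtain H :: "'a set monoid" and h where hom: "group_hom G H h"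
    and h: "\<And>x y. \<lbrakk>x \<in> carrier G; y \<in> carrier G\<rbrakk> \<Longrightarrow> h x = h y \<longleftrightarrow> x \<otimes> inv y \<in> U"
    using quotient_map[OF U] by blast
  interpret h: group_hom G H h by fact
  obtain x where x: "x \<in> V" and gen: "\<And>y. y \<in> V \<Longrightarrow> \<exists>k::int. h y = h x [^]\<^bsub>H\<^esub> k"
    using cyc h unfolding cyclic_over_def by (metis V.mem_carrier h.hom_int_pow int_pow_closed)
  obtain l :: int where l: "h (g \<otimes> x \<otimes> inv g) = h x [^]\<^bsub>H\<^esub> l"
    using gen[OF norm[OF x]] by blast
  have "(g \<otimes> y \<otimes> inv g) \<otimes> inv (y [^] l) \<in> U" if y: "y \<in> V" for y
  proof -
    have c: "y \<in> carrier G" "x \<in> carrier G" using x y by auto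
    obtain k :: int where k: "h y = h x [^]\<^bsub>H\<^esub> k" using gen[OF y] by blast
    have "h (g \<otimes> y \<otimes> inv g) = h g \<otimes>\<^bsub>H\<^esub> h x [^]\<^bsub>H\<^esub> k \<otimes>\<^bsub>H\<^esub> inv\<^bsub>H\<^esub> h g"
      using g c k by simp
    also have "\<dots> = (h (g \<otimes> x \<otimes> inv g)) [^]\<^bsub>H\<^esub> k"
      using g c by (simp add: h.H.int_pow_conj)
    also have "\<dots> = (h x [^]\<^bsub>H\<^esub> k) [^]\<^bsub>H\<^esub> l"
      using c by (simp add: l h.H.int_pow_pow mult.commute)
    also have "\<dots> = h (y [^] l)" using c k by (simp add: h.hom_int_pow)
    finally show ?thesis using h[of "g \<otimes> y \<otimes> inv g" "y [^] l"] c g by blast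
  qed
  then show ?thesis by blast
qed

text \<open>The automorphism group of a cyclic group is abelian, so commutators act trivially on \<open>V / U\<close>.\<close>
lemma (in group) derived_centralizes_cyclic_factor:
  assumes U: "U \<lhd> G" and V: "V \<lhd> G" and cyc: "cyclic_over G U V"
    and y: "y \<in> V" and c: "c \<in> derived G (carrier G)"
  shows "y \<otimes> c \<otimes> inv y \<otimes> inv c \<in> U"
proof -
  interpret V: normal V G by fact
  obtain H :: "'a set monoid" and h where hom: "group_hom G H h"
    and h: "\<And>x y. \<lbrakk>x \<in> carrier G; y \<in> carrier G\<rbrakk> \<Longrightarrow> h x = h y \<longleftrightarrow> x \<otimes> inv y \<in> U"
    using quotient_map[OF U] by blast
  interpret h: group_hom G H h by fact
  have "\<forall>g\<in>carrier G. \<exists>l::int. \<forall>y\<in>V. h (g \<otimes> y \<otimes> inv g) = h y [^]\<^bsub>H\<^esub> l"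
  proof
    fix g assume g: "g \<in> carrier G"
    obtain l :: int where l: "\<forall>y\<in>V. (g \<otimes> y \<otimes> inv g) \<otimes> inv (y [^] l) \<in> U"
      using cyclic_over_conj_pow[OF U V.subgroup_axioms cyc g] V.inv_op_closed2[OF g] by blast
    have "h (g \<otimes> y \<otimes> inv g) = h y [^]\<^bsub>H\<^esub> l" if "y \<in> V" for y
      using l that h[of "g \<otimes> y \<otimes> inv g" "y [^] l"] g V.mem_carrier[OF that]
      by (simp add: h.hom_int_pow)
    then show "\<exists>l::int. \<forall>y\<in>V. h (g \<otimes> y \<otimes> inv g) = h y [^]\<^bsub>H\<^esub> l" by blast
  qed
  then obtain l :: "'a \<Rightarrow> int" where
    l: "\<And>g y. \<lbrakk>g \<in> carrier G; y \<in> V\<rbrakk> \<Longrightarrow> h (g \<otimes> y \<otimes> inv g) = h y [^]\<^bsub>H\<^esub> l g"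
    by metis
  define C where "C = {c \<in> carrier G. \<forall>y\<in>V. h (c \<otimes> y \<otimes> inv c) = h y}"
  have "subgroup C G"
  proof (rule subgroupI)
    show "C \<subseteq> carrier G" by (auto simp: C_def)
    show "C \<noteq> {}" using V.mem_carrier by (auto simp: C_def intro!: exI[of _ \<one>])
  next
    fix a assume a: "a \<in> C"
    have "h (inv a \<otimes> y \<otimes> inv (inv a)) = h y" if y: "y \<in> V" for y
    proof -
      have "inv a \<otimes> y \<otimes> a \<in> V" using a y by (simp add: C_def V.inv_op_closed1)
      then have "h (a \<otimes> (inv a \<otimes> y \<otimes> a) \<otimes> inv a) = h (inv a \<otimes> y \<otimes> a)"
        using a unfolding C_def by blast
      moreover have "a \<otimes> (inv a \<otimes> y \<otimes> a) \<otimes> inv a = y"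
        using a y by (simp add: C_def m_assoc) (simp add: m_assoc[symmetric])
      moreover have "inv (inv a) = a" using a by (simp add: C_def)
      ultimately show ?thesis by argo
    qed
    then show "inv a \<in> C" using a unfolding C_def by blast
  next
    fix a b assume a: "a \<in> C" and b: "b \<in> C"
    have "h (a \<otimes> b \<otimes> y \<otimes> inv (a \<otimes> b)) = h y" if y: "y \<in> V" for y
    proof -
      have "b \<otimes> y \<otimes> inv b \<in> V" using b y by (simp add: C_def V.inv_op_closed2)
      then have "h (a \<otimes> (b \<otimes> y \<otimes> inv b) \<otimes> inv a) = h y"
        using a b y unfolding C_def by force
      moreover have "a \<otimes> (b \<otimes> y \<otimes> inv b) \<otimes> inv a = a \<otimes> b \<otimes> y \<otimes> inv (a \<otimes> b)"
        using a b y by (simp add: C_def m_assoc inv_mult_group)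
      ultimately show ?thesis by simp
    qed
    then show "a \<otimes> b \<in> C" using a b unfolding C_def by blast
  qed
  moreover have "derived_set G (carrier G) \<subseteq> C"
  proof
    fix d assume "d \<in> derived_set G (carrier G)"
    then obtain a b where ab: "a \<in> carrier G" "b \<in> carrier G"
      and d: "d = a \<otimes> b \<otimes> inv a \<otimes> inv b" by blast
    have "h (d \<otimes> y \<otimes> inv d) = h y" if y: "y \<in> V" for y
    proof -
      \<comment> \<open>Conjugation acts on \<open>V / U\<close> by powers, and power maps commute: so \<open>d\<close> acts as
          \<open>a a\<inverse> b b\<inverse> = 1\<close>.\<close>
      define y1 where "y1 = inv b \<otimes> y \<otimes> inv (inv b)"
      define y2 where "y2 = inv a \<otimes> y1 \<otimes> inv (inv a)"
      define y3 where "y3 = b \<otimes> y2 \<otimes> inv b"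
      define z2 where "z2 = b \<otimes> y1 \<otimes> inv b"
      define z3 where "z3 = inv a \<otimes> z2 \<otimes> inv (inv a)"
      have y1: "y1 \<in> V" unfolding y1_def using ab y V.inv_op_closed2[OF inv_closed] by blast
      have y2: "y2 \<in> V" unfolding y2_def using ab y1 V.inv_op_closed2[OF inv_closed] by blast
      have y3: "y3 \<in> V" unfolding y3_def using ab y2 V.inv_op_closed2 by blast
      have z2: "z2 \<in> V" unfolding z2_def using ab y1 V.inv_op_closed2 by blast
      have z3: "z3 \<in> V" unfolding z3_def using ab z2 V.inv_op_closed2[OF inv_closed] by blast
      note yc = y[THEN V.mem_carrier] y1[THEN V.mem_carrier] y2[THEN V.mem_carrier]
      have "d \<otimes> y \<otimes> inv d = a \<otimes> y3 \<otimes> inv a"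
        using ab y unfolding d y3_def y2_def y1_def by (simp add: m_assoc inv_mult_group)
      also have "h \<dots> = ((h y1 [^]\<^bsub>H\<^esub> l (inv a)) [^]\<^bsub>H\<^esub> l b) [^]\<^bsub>H\<^esub> l a"
        using l[OF ab(1) y3] l[OF ab(2) y2] l[OF inv_closed[OF ab(1)] y1]
        by (simp only: y3_def y2_def)
      also have "\<dots> = ((h y1 [^]\<^bsub>H\<^esub> l b) [^]\<^bsub>H\<^esub> l (inv a)) [^]\<^bsub>H\<^esub> l a"
        using yc by (simp add: h.H.int_pow_pow mult.commute)
      also have "\<dots> = h (a \<otimes> z3 \<otimes> inv a)"
        using l[OF ab(1) z3] l[OF inv_closed[OF ab(1)] z2] l[OF ab(2) y1]
        by (simp only: z3_def z2_def)
      also have "a \<otimes> z3 \<otimes> inv a = y"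
      proof -
        have "z2 = y" using ab yc unfolding z2_def y1_def
          by (simp add: m_assoc) (simp add: m_assoc[symmetric])
        then show ?thesis using ab yc unfolding z3_def
          by (simp add: m_assoc) (simp add: m_assoc[symmetric])
      qed
      finally show ?thesis .
    qed
    moreover have "d \<in> carrier G" using ab by (simp add: d)
    ultimately show "d \<in> C" unfolding C_def by blast
  qed
  ultimately have "c \<in> C"
    using c generate_subgroup_incl unfolding derived_def by blast
  then have cc: "c \<in> carrier G" and "h (c \<otimes> y \<otimes> inv c) = h y" using y unfolding C_def by blast+
  then have "h (c \<otimes> y \<otimes> inv c) \<otimes>\<^bsub>H\<^esub> h c = h (y \<otimes> c)"
    using V.mem_carrier[OF y] by simp
  moreover have "h (c \<otimes> y \<otimes> inv c) \<otimes>\<^bsub>H\<^esub> h c = h (c \<otimes> y)"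
    using cc V.mem_carrier[OF y] by (simp add: h.H.m_assoc)
  ultimately have "h (y \<otimes> c) = h (c \<otimes> y)" by simp
  then have "(y \<otimes> c) \<otimes> inv (c \<otimes> y) \<in> U"
    using h[of "y \<otimes> c" "c \<otimes> y"] cc V.mem_carrier[OF y] by blast
  then show ?thesis using cc V.mem_carrier[OF y] by (simp add: inv_mult_group m_assoc)
qed

lemma (in group) prime_index_imp_cyclic_over:
  assumes fin: "finite (carrier G)" and U: "U \<lhd> G" and L: "subgroup L G" and UL: "U \<subseteq> L"
    and p: "Factorial_Ring.prime p" and card: "card L = p * card U"
  shows "cyclic_over G U L"
proof -
  interpret U: normal U G by fact
  interpret L: subgroup L G by fact
  have finL: "finite L" "finite U" using fin L.subset UL by (auto intro: finite_subset)
  then have posU: "card U > 0" using U.one_closed card_gt_0_iff by blast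
  have "U \<noteq> L" using card posU p prime_gt_1_nat[OF p] by auto
  then obtain x where x: "x \<in> L" "x \<notin> U" using UL by blast
  define D where "D = U <#> generate G {x}"
  have xc: "x \<in> carrier G" using x by auto
  have gx: "subgroup (generate G {x}) G" by (rule generate_is_subgroup) (use xc in auto)
  have D: "subgroup D G" unfolding D_def by (rule mult_norm_subgroup[OF U gx])
  have gL: "generate G {x} \<subseteq> L" using x by (intro generate_subgroup_incl[OF _ L]) auto
  have DL: "D \<subseteq> L" unfolding D_def using gL UL by (auto simp: set_mult_def)
  have UD: "U \<subseteq> D" unfolding D_def set_mult_def using generate.one[of G "{x}"] by force
  have "x = \<one> \<otimes> x" using xc by simp
  then have xD: "x \<in> D" unfolding D_def set_mult_def using generate.incl[of x "{x}" G] U.one_closed by blast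
  obtain c where c: "card D = card U * c"
    using card_subgroup_dvd[OF U.subgroup_axioms D UD] by (metis dvdE)
  have "card U * c dvd card U * p"
    using card_subgroup_dvd[OF D L DL] c card by (simp add: mult.commute)
  then have "c dvd p" using posU by simp
  moreover have "c \<noteq> 1"
  proof
    assume "c = 1"
    then have "U = D" using c UD DL finL by (metis card_subset_eq finite_subset mult.right_neutral)
    then show False using xD x by simp
  qed
  ultimately have "c = p" using p by (auto simp: prime_nat_iff)
  then have "D = L" using c card DL finL by (simp add: card_subset_eq mult.commute)
  have "\<exists>k::int. y \<otimes> inv (x [^] k) \<in> U" if "y \<in> L" for y
  proof -
    have "y \<in> D" using that \<open>D = L\<close> by simp
    then obtain u k where "u \<in> U" and "y = u \<otimes> x [^] (k::int)"
      unfolding D_def set_mult_def generate_pow[OF xc] by auto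
    then have "y \<otimes> inv (x [^] k) = u" using xc by (simp add: m_assoc)
    then show ?thesis using \<open>u \<in> U\<close> by auto
  qed
  then show ?thesis unfolding cyclic_over_def using x by blast
qed

section \<open>Supersoluble groups and prime chains\<close>

text \<open>
  Let \<open>n\<close> be the order of the generator \<open>x\<close> modulo \<open>U\<close> and \<open>p\<close> a prime divisor of \<open>n\<close>. The
  subgroup \<open>Z\<close> generated by \<open>U\<close> and \<open>x\<^sup>n\<^sup>/\<^sup>p\<close> is normal, as conjugation acts on \<open>V / U\<close> by powers.
\<close>
lemma (in group) cyclic_over_prime_step:
  assumes fin: "finite (carrier G)" and U: "U \<lhd> G" and V: "V \<lhd> G" and UV: "U \<subset> V"
    and cyc: "cyclic_over G U V"
  shows "\<exists>Z p. Z \<lhd> G \<and> U \<subseteq> Z \<and> Z \<subseteq> V \<and> Factorial_Ring.prime p \<and> card Z = p * card U"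
proof -
  interpret U: normal U G by fact
  interpret V: normal V G by fact
  obtain x where x: "x \<in> V" and gen: "\<forall>y\<in>V. \<exists>k::int. y \<otimes> inv (x [^] k) \<in> U"
    using cyc by (auto simp: cyclic_over_def)
  have xc: "x \<in> carrier G" using x by auto
  have "x \<notin> U"
  proof
    assume xU: "x \<in> U"
    have "y \<in> U" if y: "y \<in> V" for y
    proof -
      obtain k :: int where k: "y \<otimes> inv (x [^] k) \<in> U" using gen y by blast
      have "x [^] k \<in> U" by (rule subgroup_int_pow_closed[OF U.subgroup_axioms xU])
      then have "y \<otimes> inv (x [^] k) \<otimes> x [^] k \<in> U" using k by blast
      then show ?thesis using xc V.mem_carrier[OF y] by (simp add: m_assoc)
    qed
    then show False using UV by blast
  qed
  define n where "n = (LEAST n::nat. n > 0 \<and> x [^] n \<in> U)"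
  have "order G > 0 \<and> x [^] order G \<in> U"
    using fin xc by (simp add: order_gt_0_iff_finite pow_order_eq_1)
  then have n: "n > 0 \<and> x [^] n \<in> U" unfolding n_def by (rule LeastI)
  have nmin: "x [^] j \<notin> U" if "0 < j" "j < n" for j :: nat
    using not_less_Least[of j "\<lambda>n. n > 0 \<and> x [^] n \<in> U"] that unfolding n_def by blast
  have "n \<noteq> 1" using n \<open>x \<notin> U\<close> xc by auto
  then obtain p where p: "Factorial_Ring.prime p" "p dvd n" using prime_factor_nat by blast
  then obtain m where m: "n = p * m" by (auto simp: dvd_def)
  have m0: "m > 0" using n m by (cases m) auto
  define z where "z = x [^] m"
  have zc: "z \<in> carrier G" using xc by (simp add: z_def)
  have zV: "z \<in> V"
    using subgroup_int_pow_closed[OF V.subgroup_axioms x, of "int m"] by (simp add: z_def int_pow_int)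
  have zp: "z [^] p \<in> U" using n m xc by (simp add: z_def nat_pow_pow mult.commute)
  have zj: "z [^] j \<notin> U" if "0 < j" "j < p" for j
  proof -
    have "z [^] j = x [^] (m * j)" using xc by (simp add: z_def nat_pow_pow)
    moreover have "0 < m * j" "m * j < n" using that m m0 by (auto simp: mult.commute)
    ultimately show ?thesis using nmin by simp
  qed
  obtain H :: "'a set monoid" and h where hom: "group_hom G H h"
    and h: "\<And>x y. \<lbrakk>x \<in> carrier G; y \<in> carrier G\<rbrakk> \<Longrightarrow> h x = h y \<longleftrightarrow> x \<otimes> inv y \<in> U"
    using quotient_map[OF U] by blast
  interpret h: group_hom G H h by fact
  define Z where "Z = {y \<in> V. \<exists>j::int. h y = h z [^]\<^bsub>H\<^esub> j}"
  have hz: "h z \<in> carrier H" using zc by simp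
  have Zsub: "subgroup Z G"
  proof (rule subgroupI)
    show "Z \<subseteq> carrier G" by (auto simp: Z_def)
    show "Z \<noteq> {}" using zV hz by (auto simp: Z_def intro!: exI[of _ z] exI[of _ "1::int"])
  next
    fix a assume "a \<in> Z"
    then obtain j :: int where "a \<in> V" "h a = h z [^]\<^bsub>H\<^esub> j" by (auto simp: Z_def)
    then have "h (inv a) = h z [^]\<^bsub>H\<^esub> (- j)" using hz by (simp add: h.H.int_pow_neg)
    then show "inv a \<in> Z" using \<open>a \<in> V\<close> unfolding Z_def by blast
  next
    fix a b assume "a \<in> Z" "b \<in> Z"
    then obtain j k :: int where "a \<in> V" "h a = h z [^]\<^bsub>H\<^esub> j" "b \<in> V" "h b = h z [^]\<^bsub>H\<^esub> k"
      by (auto simp: Z_def)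
    then have "h (a \<otimes> b) = h z [^]\<^bsub>H\<^esub> (j + k)" using hz by (simp add: h.H.int_pow_mult)
    then show "a \<otimes> b \<in> Z" using \<open>a \<in> V\<close> \<open>b \<in> V\<close> unfolding Z_def by blast
  qed
  have Znorm: "Z \<lhd> G"
  proof (rule normal_invI[OF Zsub])
    fix g y assume g: "g \<in> carrier G" and "y \<in> Z"
    then obtain j :: int where y: "y \<in> V" "h y = h z [^]\<^bsub>H\<^esub> j" by (auto simp: Z_def)
    obtain l :: int where l: "\<forall>y\<in>V. (g \<otimes> y \<otimes> inv g) \<otimes> inv (y [^] l) \<in> U"
      using cyclic_over_conj_pow[OF U V.subgroup_axioms cyc g] V.inv_op_closed2[OF g] by blast
    have "h (g \<otimes> y \<otimes> inv g) = h (y [^] l)"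
      using h[of "g \<otimes> y \<otimes> inv g" "y [^] l"] l y(1) g V.mem_carrier[OF y(1)]
      by (metis V.mem_carrier V.inv_op_closed2 int_pow_closed)
    then have "h (g \<otimes> y \<otimes> inv g) = h z [^]\<^bsub>H\<^esub> (j * l)"
      using y hz by (simp add: h.hom_int_pow h.H.int_pow_pow)
    then show "g \<otimes> y \<otimes> inv g \<in> Z"
      using V.inv_op_closed2[OF g y(1)] unfolding Z_def by blast
  qed
  have UZ: "U \<subseteq> Z"
  proof
    fix u assume u: "u \<in> U"
    then have "h u = h \<one>" using h[of u \<one>] by simp
    then have "h u = h z [^]\<^bsub>H\<^esub> (0::int)" by simp
    then show "u \<in> Z" using u UV unfolding Z_def by blast
  qed
  \<comment> \<open>\<open>Z\<close> is the disjoint union of the cosets \<open>U z\<^sup>j\<close> with \<open>j < p\<close>.\<close>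
  have aux: "i = j" if "u \<in> U" "v \<in> U" "i \<le> j" "j < p" "u \<otimes> z [^] i = v \<otimes> z [^] j" for u v and i j :: nat
  proof (rule ccontr)
    assume "i \<noteq> j"
    have c: "u \<in> carrier G" "v \<in> carrier G" using that by auto
    have "z [^] j = z [^] (j - i) \<otimes> z [^] i" using zc that(3) by (simp add: nat_pow_mult)
    then have "u \<otimes> z [^] i = (v \<otimes> z [^] (j - i)) \<otimes> z [^] i"
      using that(5) c zc by (simp add: m_assoc)
    then have "u = v \<otimes> z [^] (j - i)" using c zc by simp
    then have "z [^] (j - i) = inv v \<otimes> u" using c zc by (simp add: m_assoc[symmetric])
    then have "z [^] (j - i) \<in> U" using that by simp
    then show False using zj[of "j - i"] \<open>i \<noteq> j\<close> that by simp
  qed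
  have "bij_betw (\<lambda>(u, j). u \<otimes> z [^] j) (U \<times> {..<p}) Z"
  proof (rule bij_betw_imageI)
    show "inj_on (\<lambda>(u, j). u \<otimes> z [^] j) (U \<times> {..<p})"
    proof (rule inj_onI, clarsimp)
      fix u v i j assume a: "u \<in> U" "v \<in> U" "i < p" "j < p" and eq: "u \<otimes> z [^] i = v \<otimes> z [^] j"
      have "i = j" using aux[OF a(1,2) _ a(4) eq] aux[OF a(2,1) _ a(3) eq[symmetric]] by linarith
      then show "u = v \<and> i = j" using eq a zc by simp
    qed
    show "(\<lambda>(u, j). u \<otimes> z [^] j) ` (U \<times> {..<p}) = Z"
    proof (intro subset_antisym subsetI)
      fix y assume "y \<in> (\<lambda>(u, j). u \<otimes> z [^] j) ` (U \<times> {..<p})"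
      then obtain u j where u: "u \<in> U" and y: "y = u \<otimes> z [^] (j::nat)" by auto
      have "z \<in> Z" using zV hz by (auto simp: Z_def intro!: exI[of _ "1::int"])
      then have "z [^] j \<in> Z"
        using subgroup_int_pow_closed[OF Zsub, of z "int j"] by (simp add: int_pow_int)
      then show "y \<in> Z" using u UZ subgroup.m_closed[OF Zsub] y by blast
    next
      fix y assume "y \<in> Z"
      then obtain k :: int where y: "y \<in> V" and k: "h y = h z [^]\<^bsub>H\<^esub> k" by (auto simp: Z_def)
      have yc: "y \<in> carrier G" using y by auto
      have "h y = h (z [^] k)" using k zc by (simp add: h.hom_int_pow)
      then have u: "y \<otimes> inv (z [^] k) \<in> U" using h yc zc by simp
      define r where "r = nat (k mod int p)"
      have p0: "int p > 0" using p by (simp add: prime_gt_0_nat)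
      have r: "int r = k mod int p" "r < p" using p0 by (auto simp: r_def nat_less_iff)
      have "z [^] k = z [^] (int p * (k div int p)) \<otimes> z [^] (int r)"
        using zc r by (simp flip: int_pow_mult)
      also have "z [^] (int p * (k div int p)) = (z [^] p) [^] (k div int p)"
        using zc by (simp add: int_pow_pow flip: int_pow_int)
      also have "z [^] (int r) = z [^] r" by (simp add: int_pow_int)
      finally have zk: "z [^] k = (z [^] p) [^] (k div int p) \<otimes> z [^] r" .
      define w where "w = (z [^] p) [^] (k div int p)"
      have w: "w \<in> U" unfolding w_def by (rule subgroup_int_pow_closed[OF U.subgroup_axioms zp])
      have "y = (y \<otimes> inv (z [^] k)) \<otimes> z [^] k" using yc zc by (simp add: m_assoc)
      also have "\<dots> = ((y \<otimes> inv (z [^] k)) \<otimes> w) \<otimes> z [^] r"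
        using yc zc w by (simp add: zk[folded w_def] m_assoc)
      finally have "y = ((y \<otimes> inv (z [^] k)) \<otimes> w) \<otimes> z [^] r" .
      moreover have "(y \<otimes> inv (z [^] k)) \<otimes> w \<in> U" using u w by blast
      ultimately show "y \<in> (\<lambda>(u, j). u \<otimes> z [^] j) ` (U \<times> {..<p})"
        using r by (intro image_eqI[of _ _ "((y \<otimes> inv (z [^] k)) \<otimes> w, r)"]) auto
    qed
  qed
  then have "card Z = p * card U"
    by (metis bij_betw_same_card card_cartesian_product card_lessThan mult.commute)
  then show ?thesis using Znorm UZ p by (intro exI[of _ Z] exI[of _ p]) (auto simp: Z_def)
qed

lemma (in group) prime_chain_cyclic_step:
  assumes fin: "finite (carrier G)" and "U \<lhd> G" and V: "V \<lhd> G" and "U \<subseteq> V"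
    and "cyclic_over G U V" and "prime_chain G (carrier G) M U"
  shows "prime_chain G (carrier G) M V"
  using assms(2,4-6)
proof (induction "card V - card U" arbitrary: U rule: less_induct)
  case less
  interpret V: normal V G by fact
  show ?case
  proof (cases "U = V")
    case False
    have finV: "finite V" using fin V.subset by (rule rev_finite_subset)
    obtain Z p where Z: "Z \<lhd> G" "U \<subseteq> Z" "Z \<subseteq> V" "Factorial_Ring.prime p" "card Z = p * card U"
      using cyclic_over_prime_step[OF fin less.prems(1) V _ less.prems(3)] less.prems(2) False by blast
    interpret U: normal U G by fact
    interpret Z: normal Z G by fact
    have "U \<noteq> {}" using U.one_closed by blast
    then have "card U > 0" using finite_subset[OF less.prems(2) finV] by (simp add: card_gt_0_iff)
    then have "card U < card Z" using Z(4,5) prime_gt_1_nat[of p] by simp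
    moreover have "card Z \<le> card V" using Z(3) finV by (simp add: card_mono)
    ultimately have lt: "card V - card Z < card V - card U" by simp
    have "prime_chain G (carrier G) M Z"
      using less.prems(4) Z.subgroup_axioms Z(2,4,5) by (rule prime_chain.step) (rule Z.inv_op_closed2)
    moreover have "cyclic_over G Z V"
      using less.prems(3) Z(2) unfolding cyclic_over_def by blast
    ultimately show ?thesis using less.hyps[OF lt Z(1,3)] by blast
  qed (use less in simp)
qed

lemma (in group) supersoluble_group_imp_cyclic_series:
  assumes "supersoluble_group G"
  obtains S :: "nat \<Rightarrow> 'a set" and n where "S 0 = {\<one>}" "S n = carrier G" "\<And>i. i \<le> n \<Longrightarrow> S i \<lhd> G"
    "\<And>i. i < n \<Longrightarrow> S i \<subseteq> S (Suc i)" "\<And>i. i < n \<Longrightarrow> cyclic_over G (S i) (S (Suc i))"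
proof -
  obtain S :: "nat \<Rightarrow> 'a set" and n where S: "S 0 = {\<one>}" "S n = carrier G" "\<forall>i\<le>n. S i \<lhd> G"
    "\<forall>i<n. S i \<subseteq> S (Suc i) \<and> cyclic_group ((G\<lparr>carrier := S (Suc i)\<rparr>) Mod S i)"
    using assms unfolding supersoluble_group_def by blast
  have "cyclic_over G (S i) (S (Suc i))" if "i < n" for i
    using S that cyclic_group_Mod_iff[of "S i" "S (Suc i)"]
    by (simp add: normal_imp_subgroup)
  with S show ?thesis by (intro that[of S n]) simp_all
qed

lemma (in group) supersoluble_group_imp_prime_chain:
  assumes fin: "finite (carrier G)" and "supersoluble_group G"
  shows "prime_chain G (carrier G) {\<one>} (carrier G)"
proof -
  obtain S :: "nat \<Rightarrow> 'a set" and n where S: "S 0 = {\<one>}" "S n = carrier G"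
    "\<And>i. i \<le> n \<Longrightarrow> S i \<lhd> G" "\<And>i. i < n \<Longrightarrow> S i \<subseteq> S (Suc i)"
    "\<And>i. i < n \<Longrightarrow> cyclic_over G (S i) (S (Suc i))"
    using supersoluble_group_imp_cyclic_series[OF assms(2)] by blast
  have "i \<le> n \<Longrightarrow> prime_chain G (carrier G) {\<one>} (S i)" for i
  proof (induction i)
    case 0
    show ?case using S(1) prime_chain.start by simp
  next
    case (Suc i)
    then show ?case using prime_chain_cyclic_step[OF fin S(3) S(3) S(4) S(5)] by simp
  qed
  then show ?thesis using S(2) by force
qed

lemma (in group) supersoluble_subgroup_imp_prime_chain:
  assumes fin: "finite (carrier G)" and A: "subgroup A G" and "supersoluble_group (G\<lparr>carrier := A\<rparr>)"
  shows "prime_chain G A {\<one>} A"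
proof -
  interpret GA: group "G\<lparr>carrier := A\<rparr>" by (rule subgroup_imp_group[OF A])
  have "finite A" using fin subgroup.subset[OF A] by (rule rev_finite_subset)
  then have "prime_chain (G\<lparr>carrier := A\<rparr>) A {\<one>} A"
    using GA.supersoluble_group_imp_prime_chain[OF _ assms(3)] by simp
  moreover have "prime_chain G A {\<one>} T" if "prime_chain (G\<lparr>carrier := A\<rparr>) A {\<one>} T" for T
    using that
  proof induction
    case start
    show ?case by (rule prime_chain.start)
  next
    case (step V Y p)
    have "a \<otimes> y \<otimes> inv a \<in> Y" if "a \<in> A" "y \<in> Y" for a y
      using step.hyps(6)[OF that] that A by simp
    then show ?case
      using step.IH incl_subgroup[OF A step.hyps(2)] step.hyps(3-5) prime_chain.step by blast
  qed
  ultimately show ?thesis by blast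
qed

lemma (in group) subgroup_set_mult_commute:
  assumes H: "subgroup H G" and K: "subgroup K G" and eq: "H <#> K = K <#> H"
  shows "subgroup (H <#> K) G"
proof (rule subgroupI)
  interpret H: subgroup H G by fact
  interpret K: subgroup K G by fact
  show "H <#> K \<subseteq> carrier G" by (rule set_mult_closed) auto
  have "\<one> \<in> H <#> K" by (rule set_mult_memI[of \<one> _ \<one>]) auto
  then show "H <#> K \<noteq> {}" by blast
  {
    fix a assume "a \<in> H <#> K"
    then obtain x y where "x \<in> H" "y \<in> K" "a = x \<otimes> y" by (auto simp: set_mult_def)
    then have "inv a \<in> K <#> H"
      by (intro set_mult_memI[of "inv y" _ "inv x"]) (auto simp: inv_mult_group)
    then show "inv a \<in> H <#> K" by (simp add: eq)
  }
  {
    fix a b assume "a \<in> H <#> K" "b \<in> H <#> K"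
    then obtain x y x' y' where a: "x \<in> H" "y \<in> K" "a = x \<otimes> y" and b: "x' \<in> H" "y' \<in> K" "b = x' \<otimes> y'"
      by (auto simp: set_mult_def)
    have "y \<otimes> x' \<in> H <#> K"
      unfolding eq by (rule set_mult_memI[OF a(2) b(1) refl])
    then obtain u v where u: "u \<in> H" "v \<in> K" "y \<otimes> x' = u \<otimes> v" by (auto simp: set_mult_def)
    have "a \<otimes> b = x \<otimes> (y \<otimes> x') \<otimes> y'" using a b by (simp add: m_assoc)
    also have "\<dots> = (x \<otimes> u) \<otimes> (v \<otimes> y')" using a b u by (simp add: m_assoc)
    finally show "a \<otimes> b \<in> H <#> K" using a b u by (intro set_mult_memI[of "x \<otimes> u" _ "v \<otimes> y'"]) auto
  }
qed

lemma (in group) set_mult_subgroup_absorb: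
  assumes Y: "subgroup Y G" and "\<one> \<in> V" "V \<subseteq> Y"
  shows "V <#> Y = Y"
proof
  interpret Y: subgroup Y G by fact
  show "V <#> Y \<subseteq> Y" using assms by (auto simp: set_mult_def)
  show "Y \<subseteq> V <#> Y" using assms(2) by (auto intro: set_mult_memI[of \<one>])
qed

text \<open>
  The chain climbs from \<open>M\<close> to \<open>M A\<close> along a normal series of \<open>A\<close>, and from \<open>M A\<close> to \<open>G\<close> along a
  normal series of \<open>B\<close>. The members of the second part contain \<open>A\<close>, hence are normalized by \<open>A\<close>.
\<close>
lemma (in group) prime_chain_of_factorization:
  assumes fin: "finite (carrier G)" and A: "subgroup A G" and B: "subgroup B G"
    and car: "carrier G = A <#> B"
    and perm: "\<And>V. \<lbrakk>subgroup V G; V \<subseteq> B\<rbrakk> \<Longrightarrow> A <#> V = V <#> A"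
    and chA: "prime_chain G A {\<one>} A" and chB: "prime_chain G B {\<one>} B" and M: "M \<lhd> G"
  shows "prime_chain G A M (carrier G)"
proof -
  interpret A: subgroup A G by fact
  interpret B: subgroup B G by fact
  interpret M: normal M G by fact
  have one: "subgroup {\<one>} G" by (rule triv_subgroup)
  have "prime_chain G A M (M <#> T)" if "prime_chain G A {\<one>} T" for T
    using that
  proof induction
    case start
    have "M <#> {\<one>} = M" using M.subset by (auto simp: set_mult_def)
    then show ?case by (simp add: prime_chain.start)
  next
    case (step V Y p)
    interpret Y: subgroup Y G by fact
    have V: "subgroup V G" using prime_chain_subgroup[OF step.hyps(1) one] by simp
    interpret V: subgroup V G by fact
    have MV: "subgroup (M <#> V) G" and MY: "subgroup (M <#> Y) G"
      using mult_norm_subgroup[OF M] V step.hyps(2) by auto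
    have "V \<subseteq> M <#> V" by (auto intro: set_mult_memI[OF M.one_closed])
    then have "card ((M <#> V) <#> Y) = card (M <#> V) \<or> card ((M <#> V) <#> Y) = p * card (M <#> V)"
      using card_set_mult_prime[OF fin MV step.hyps(2) V step.hyps(3)] step.hyps by blast
    moreover have "(M <#> V) <#> Y = M <#> Y"
      using set_mult_assoc[OF M.subset V.subset Y.subset]
        set_mult_subgroup_absorb[OF step.hyps(2) V.one_closed step.hyps(3)] by simp
    moreover have "a \<otimes> y \<otimes> inv a \<in> M <#> Y" if a: "a \<in> A" and y: "y \<in> M <#> Y" for a y
    proof -
      obtain m t where mt: "m \<in> M" "t \<in> Y" "y = m \<otimes> t" using y by (auto simp: set_mult_def)
      have "a \<otimes> m \<otimes> inv a \<in> M" "a \<otimes> t \<otimes> inv a \<in> Y"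
        using M.inv_op_closed2 step.hyps(6) a mt by auto
      moreover have "a \<otimes> y \<otimes> inv a = (a \<otimes> m \<otimes> inv a) \<otimes> (a \<otimes> t \<otimes> inv a)"
        using a mt by (simp add: m_assoc inv_solve_left)
      ultimately show ?thesis by (rule set_mult_memI)
    qed
    moreover have "M <#> V \<subseteq> M <#> Y" using step.hyps(3) by (auto simp: set_mult_def)
    ultimately show ?case
      using prime_chain_weak_step[OF step.IH fin MY _ step.hyps(4)] by auto
  qed
  from this[OF chA] have chMA: "prime_chain G A M (M <#> A)" .
  have "S \<subseteq> B \<longrightarrow> prime_chain G A M (M <#> (A <#> S))" if "prime_chain G B {\<one>} S" for S
    using that
  proof induction
    case start
    have "A <#> {\<one>} = A" using A.subset by (auto simp: set_mult_def)
    then show ?case using chMA by simp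
  next
    case (step V Y p)
    show ?case
    proof
      assume YB: "Y \<subseteq> B"
      interpret Y: subgroup Y G by fact
      have V: "subgroup V G" using prime_chain_subgroup[OF step.hyps(1) one] by simp
      interpret V: subgroup V G by fact
      have AV: "subgroup (A <#> V) G" and AY: "subgroup (A <#> Y) G"
        using subgroup_set_mult_commute[OF A] perm V step.hyps(2,3) YB by auto
      have MV: "subgroup (M <#> (A <#> V)) G" and MY: "subgroup (M <#> (A <#> Y)) G"
        using mult_norm_subgroup[OF M] AV AY by auto
      have "v \<in> M <#> (A <#> V)" if "v \<in> V" for v
        using that by (auto intro!: set_mult_memI[OF M.one_closed] set_mult_memI[OF A.one_closed])
      then have "V \<subseteq> M <#> (A <#> V)" by blast
      then have "card ((M <#> (A <#> V)) <#> Y) = card (M <#> (A <#> V))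
          \<or> card ((M <#> (A <#> V)) <#> Y) = p * card (M <#> (A <#> V))"
        using card_set_mult_prime[OF fin MV step.hyps(2) V step.hyps(3)] step.hyps by blast
      moreover have "(M <#> (A <#> V)) <#> Y = M <#> (A <#> Y)"
        using set_mult_assoc[OF M.subset subgroup.subset[OF AV] Y.subset]
          set_mult_assoc[OF A.subset V.subset Y.subset]
          set_mult_subgroup_absorb[OF step.hyps(2) V.one_closed step.hyps(3)] by simp
      moreover have "a \<otimes> y \<otimes> inv a \<in> M <#> (A <#> Y)" if a: "a \<in> A" and y: "y \<in> M <#> (A <#> Y)" for a y
      proof -
        have "a \<in> M <#> (A <#> Y)"
          using a by (auto intro!: set_mult_memI[OF M.one_closed] set_mult_memI[OF a Y.one_closed])
        then show ?thesis using y MY by (simp add: subgroup.m_closed subgroup.m_inv_closed)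
      qed
      moreover have "M <#> (A <#> V) \<subseteq> M <#> (A <#> Y)" 
        using step.hyps(3) by (intro mono_set_mult) auto
      moreover have "prime_chain G A M (M <#> (A <#> V))" using step.IH step.hyps(3) YB by blast
      ultimately show "prime_chain G A M (M <#> (A <#> Y))"
        using prime_chain_weak_step[OF _ fin MY _ step.hyps(4)] by auto
    qed
  qed
  from this[OF chB] have "prime_chain G A M (M <#> carrier G)" by (simp add: car)
  moreover have "M <#> carrier G = carrier G"
    using set_mult_subgroup_absorb[OF subgroup_self M.one_closed M.subset] .
  ultimately show ?thesis by simp
qed

section \<open>Commutator subgroups and the lower central series\<close>

lemma (in group) commutator_mem:
  "\<lbrakk>x \<in> H; y \<in> K\<rbrakk> \<Longrightarrow> x \<otimes> y \<otimes> inv x \<otimes> inv y \<in> commutator_subgroup G H K"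
  unfolding commutator_subgroup_def by (rule generate.incl) blast

lemma (in group) commutator_subgroup_subset:
  assumes "subgroup E G" "\<And>x y. \<lbrakk>x \<in> H; y \<in> K\<rbrakk> \<Longrightarrow> x \<otimes> y \<otimes> inv x \<otimes> inv y \<in> E"
  shows "commutator_subgroup G H K \<subseteq> E"
  unfolding commutator_subgroup_def using assms by (intro generate_subgroup_incl) auto

lemma (in group) commutator_subgroup_is_subgroup:
  assumes "H \<subseteq> carrier G" "K \<subseteq> carrier G"
  shows "subgroup (commutator_subgroup G H K) G"
  unfolding commutator_subgroup_def using assms by (intro generate_is_subgroup) (auto simp: subset_iff)

lemma (in group) commutator_subgroup_mono:
  assumes "H \<subseteq> H'" "K \<subseteq> K'"
  shows "commutator_subgroup G H K \<subseteq> commutator_subgroup G H' K'"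
  unfolding commutator_subgroup_def using assms by (intro mono_generate) blast

lemma (in group) commutator_subgroup_consistent:
  assumes E: "subgroup E G" and "H \<subseteq> E" "K \<subseteq> E"
  shows "commutator_subgroup (G\<lparr>carrier := E\<rparr>) H K = commutator_subgroup G H K"
proof -
  interpret E: subgroup E G by fact
  have eq: "h \<otimes>\<^bsub>G\<lparr>carrier := E\<rparr>\<^esub> k \<otimes>\<^bsub>G\<lparr>carrier := E\<rparr>\<^esub> inv\<^bsub>G\<lparr>carrier := E\<rparr>\<^esub> h
      \<otimes>\<^bsub>G\<lparr>carrier := E\<rparr>\<^esub> inv\<^bsub>G\<lparr>carrier := E\<rparr>\<^esub> k = h \<otimes> k \<otimes> inv h \<otimes> inv k"
    if "h \<in> H" "k \<in> K" for h k
    using assms that by (simp add: subset_iff)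
  have "{h \<otimes>\<^bsub>G\<lparr>carrier := E\<rparr>\<^esub> k \<otimes>\<^bsub>G\<lparr>carrier := E\<rparr>\<^esub> inv\<^bsub>G\<lparr>carrier := E\<rparr>\<^esub> h
            \<otimes>\<^bsub>G\<lparr>carrier := E\<rparr>\<^esub> inv\<^bsub>G\<lparr>carrier := E\<rparr>\<^esub> k | h k. h \<in> H \<and> k \<in> K}
        = {h \<otimes> k \<otimes> inv h \<otimes> inv k | h k. h \<in> H \<and> k \<in> K}"
    using eq by (intro Collect_cong) metis
  moreover have "{h \<otimes> k \<otimes> inv h \<otimes> inv k | h k. h \<in> H \<and> k \<in> K} \<subseteq> E"
    using assms by (auto intro!: E.m_closed E.m_inv_closed)
  ultimately show ?thesis
    unfolding commutator_subgroup_def by (simp only: generate_consistent[OF _ E])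
qed

lemma (in group) commutator_subgroup_normal:
  assumes H: "H \<lhd> G" and K: "K \<lhd> G"
  shows "commutator_subgroup G H K \<lhd> G"
  unfolding commutator_subgroup_def
proof (rule normal_generateI)
  interpret H: normal H G by fact
  interpret K: normal K G by fact
  show "{h \<otimes> k \<otimes> inv h \<otimes> inv k | h k. h \<in> H \<and> k \<in> K} \<subseteq> carrier G" by auto
  fix c g assume "c \<in> {h \<otimes> k \<otimes> inv h \<otimes> inv k | h k. h \<in> H \<and> k \<in> K}" and g: "g \<in> carrier G"
  then obtain x y where xy: "x \<in> H" "y \<in> K" "c = x \<otimes> y \<otimes> inv x \<otimes> inv y" by auto
  have "g \<otimes> c \<otimes> inv g = (g \<otimes> x \<otimes> inv g) \<otimes> (g \<otimes> y \<otimes> inv g)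
      \<otimes> inv (g \<otimes> x \<otimes> inv g) \<otimes> inv (g \<otimes> y \<otimes> inv g)"
    using g xy by (simp add: m_assoc inv_mult_group inv_cancel_left)
  moreover have "g \<otimes> x \<otimes> inv g \<in> H" "g \<otimes> y \<otimes> inv g \<in> K"
    using g xy H.inv_op_closed2 K.inv_op_closed2 by auto
  ultimately show "g \<otimes> c \<otimes> inv g \<in> {h \<otimes> k \<otimes> inv h \<otimes> inv k | h k. h \<in> H \<and> k \<in> K}" by blast
qed

lemma (in group_hom) commutator_subgroup_img:
  assumes "S \<subseteq> carrier G" "T \<subseteq> carrier G"
  shows "commutator_subgroup H (h ` S) (h ` T) = h ` commutator_subgroup G S T"
proof -
  have eq: "h (x \<otimes> y \<otimes> inv x \<otimes> inv y) = h x \<otimes>\<^bsub>H\<^esub> h y \<otimes>\<^bsub>H\<^esub> inv\<^bsub>H\<^esub> h x \<otimes>\<^bsub>H\<^esub> inv\<^bsub>H\<^esub> h y"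
    if "x \<in> S" "y \<in> T" for x y
    using assms that by (simp add: subset_iff)
  have "{x \<otimes>\<^bsub>H\<^esub> y \<otimes>\<^bsub>H\<^esub> inv\<^bsub>H\<^esub> x \<otimes>\<^bsub>H\<^esub> inv\<^bsub>H\<^esub> y | x y. x \<in> h ` S \<and> y \<in> h ` T}
      = h ` {x \<otimes> y \<otimes> inv x \<otimes> inv y | x y. x \<in> S \<and> y \<in> T}" (is "?L = ?R")
  proof
    show "?L \<subseteq> ?R"
    proof
      fix z assume "z \<in> ?L"
      then obtain x y where "x \<in> S" "y \<in> T" "z = h (x \<otimes> y \<otimes> inv x \<otimes> inv y)" using eq by force
      then show "z \<in> ?R" by blast
    qed
    show "?R \<subseteq> ?L" using eq by force
  qed
  moreover have "{x \<otimes> y \<otimes> inv x \<otimes> inv y | x y. x \<in> S \<and> y \<in> T} \<subseteq> carrier G"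
    using assms by (auto simp: subset_iff)
  ultimately show ?thesis unfolding commutator_subgroup_def by (simp only: generate_img)
qed

lemma (in group) lower_central_normal: "lower_central G n \<lhd> G"
proof (induction n)
  case 0
  show ?case using normal_invI[OF subgroup_self] by simp
next
  case (Suc n)
  show ?case using commutator_subgroup_normal[OF Suc.IH normal_invI[OF subgroup_self]] by simp
qed

lemma (in group) lower_central_Suc_subset: "lower_central G (Suc n) \<subseteq> lower_central G n"
proof -
  interpret N: normal "lower_central G n" G by (rule lower_central_normal)
  have "x \<otimes> y \<otimes> inv x \<otimes> inv y \<in> lower_central G n" if "x \<in> lower_central G n" "y \<in> carrier G" for x y
  proof -
    have "x \<otimes> (y \<otimes> inv x \<otimes> inv y) \<in> lower_central G n"
      using that by (intro N.m_closed N.inv_op_closed2) auto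
    then show ?thesis using that by (simp add: m_assoc)
  qed
  then show ?thesis by (simp add: commutator_subgroup_subset N.subgroup_axioms)
qed

lemma (in group) lower_central_antimono: "m \<le> n \<Longrightarrow> lower_central G n \<subseteq> lower_central G m"
  by (rule lift_Suc_antimono_le[of "lower_central G", OF lower_central_Suc_subset])

lemma (in group) lower_central_subgroup_subset:
  assumes "subgroup K G"
  shows "lower_central (G\<lparr>carrier := K\<rparr>) n \<subseteq> K"
  using group.lower_central_antimono[OF subgroup_imp_group[OF assms], of 0 n] by simp

lemma (in group) lower_central_subgroup_Suc:
  assumes "subgroup K G"
  shows "lower_central (G\<lparr>carrier := K\<rparr>) (Suc n)
    = commutator_subgroup G (lower_central (G\<lparr>carrier := K\<rparr>) n) K"
  using commutator_subgroup_consistent[OF assms lower_central_subgroup_subset[OF assms] order.refl]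
  by simp

lemma (in group) lower_central_of_normal_subgroup:
  assumes "K \<lhd> G"
  shows "lower_central (G\<lparr>carrier := K\<rparr>) n \<lhd> G"
proof (induction n)
  case 0
  show ?case using assms by simp
next
  case (Suc n)
  show ?case
    unfolding lower_central_subgroup_Suc[OF normal_imp_subgroup[OF assms]]
    by (rule commutator_subgroup_normal[OF Suc.IH assms])
qed

lemma (in group) lower_central_subgroup_mono:
  assumes "subgroup K G" "subgroup K' G" "K \<subseteq> K'"
  shows "lower_central (G\<lparr>carrier := K\<rparr>) n \<subseteq> lower_central (G\<lparr>carrier := K'\<rparr>) n"
proof (induction n)
  case 0
  show ?case using assms by simp
next
  case (Suc n)
  show ?case
    unfolding lower_central_subgroup_Suc[OF assms(1)] lower_central_subgroup_Suc[OF assms(2)]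
    by (rule commutator_subgroup_mono[OF Suc.IH assms(3)])
qed

lemma (in group_hom) lower_central_img:
  assumes "h ` carrier G = carrier H"
  shows "lower_central H n = h ` lower_central G n"
proof (induction n)
  case 0
  show ?case using assms by simp
next
  case (Suc n)
  have "lower_central G n \<subseteq> carrier G"
    using G.lower_central_normal normal_imp_subgroup subgroup.subset by blast
  then show ?case
    using commutator_subgroup_img[of "lower_central G n" "carrier G"] Suc.IH assms by simp
qed

section \<open>Nilpotent and supersoluble quotients\<close>
lemma (in group) nilpotent_group_Mod_iff:
  assumes N: "N \<lhd> G"
  shows "nilpotent_group (G Mod N) \<longleftrightarrow> (\<exists>n. lower_central G n \<subseteq> N)"
proof -
  interpret N: normal N G by fact
  interpret Q: group "G Mod N" by (rule N.factorgroup_is_group)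
  interpret h: group_hom G "G Mod N" "\<lambda>a. N #> a"
    by unfold_locales (rule N.r_coset_hom_Mod)
  have "lower_central (G Mod N) n = {\<one>\<^bsub>G Mod N\<^esub>} \<longleftrightarrow> lower_central G n \<subseteq> N" for n
  proof -
    interpret L: normal "lower_central G n" G by (rule lower_central_normal)
    have img: "lower_central (G Mod N) n = (\<lambda>a. N #> a) ` lower_central G n"
      by (rule h.lower_central_img) (simp add: carrier_FactGroup)
    show ?thesis
    proof
      assume triv: "lower_central (G Mod N) n = {\<one>\<^bsub>G Mod N\<^esub>}"
      show "lower_central G n \<subseteq> N"
      proof
        fix x assume x: "x \<in> lower_central G n"
        then have "N #> x = N" using img triv by auto
        then show "x \<in> N" using coset_join1[OF _ _ N.subgroup_axioms] x by simp
      qed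
    next
      assume sub: "lower_central G n \<subseteq> N"
      have "N #> x = N" if "x \<in> lower_central G n" for x
        using coset_join2[OF _ N.subgroup_axioms] sub that by auto
      moreover have "lower_central G n \<noteq> {}" using L.one_closed by blast
      ultimately show "lower_central (G Mod N) n = {\<one>\<^bsub>G Mod N\<^esub>}"
        unfolding img by auto
    qed
  qed
  then show ?thesis unfolding nilpotent_group_def using Q.group_axioms by simp
qed

text \<open>In a finite group the lower central series becomes stationary, and the residual is its last term.\<close>
lemma (in group) nilpotent_residual:
  assumes fin: "finite (carrier G)"
  obtains n where "residual nilpotent_group G = lower_central G n"
    and "\<And>m. lower_central G n \<subseteq> lower_central G m"
proof -
  obtain n where n: "\<And>m. card (lower_central G n) \<le> card (lower_central G m)"
    using ex_has_least_nat[of "\<lambda>_. True" 0 "\<lambda>n. card (lower_central G n)"] by blast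
  have le: "lower_central G n \<subseteq> lower_central G m" for m
  proof -
    have "finite (lower_central G n)"
      using fin subgroup.subset[OF normal_imp_subgroup[OF lower_central_normal]]
      by (rule rev_finite_subset)
    then have "lower_central G (max m n) = lower_central G n"
      using n[of "max m n"] lower_central_antimono[of n "max m n"] by (intro card_seteq) auto
    then show ?thesis using lower_central_antimono[of m "max m n"] by auto
  qed
  have "residual nilpotent_group G = lower_central G n"
    unfolding residual_def
  proof (rule Least_equality)
    show "lower_central G n \<lhd> G \<and> nilpotent_group (G Mod lower_central G n)"
      using lower_central_normal nilpotent_group_Mod_iff by blast
    fix N assume "N \<lhd> G \<and> nilpotent_group (G Mod N)"
    then show "lower_central G n \<le> N" using nilpotent_group_Mod_iff le by blast
  qed
  then show ?thesis using le by (rule that)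
qed

text \<open>
  For a normal series \<open>S 0 \<subseteq> \<dots> \<subseteq> S n\<close> of \<open>G\<close> with cyclic factors, the \<open>i\<close>-th term of the lower
  central series of \<open>G'\<close> lies in \<open>S (n - i)\<close>, as \<open>G'\<close> centralizes the factors.
\<close>
lemma (in group) supersoluble_imp_derived_nilpotent:
  assumes "supersoluble_group G"
  shows "\<exists>n. lower_central (G\<lparr>carrier := derived G (carrier G)\<rparr>) n = {\<one>}"
proof -
  obtain S :: "nat \<Rightarrow> 'a set" and n where S: "S 0 = {\<one>}" "S n = carrier G"
    "\<And>i. i \<le> n \<Longrightarrow> S i \<lhd> G" "\<And>i. i < n \<Longrightarrow> S i \<subseteq> S (Suc i)"
    "\<And>i. i < n \<Longrightarrow> cyclic_over G (S i) (S (Suc i))"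
    using supersoluble_group_imp_cyclic_series[OF assms] by blast
  let ?D = "derived G (carrier G)"
  have D: "subgroup ?D G" by (rule derived_is_subgroup) simp
  interpret D: group "G\<lparr>carrier := ?D\<rparr>" by (rule subgroup_imp_group[OF D])
  have "i \<le> n \<Longrightarrow> lower_central (G\<lparr>carrier := ?D\<rparr>) i \<subseteq> S (n - i)" for i
  proof (induction i)
    case 0
    show ?case using S(2) subgroup.subset[OF D] by simp
  next
    case (Suc i)
    define j where "j = n - Suc i"
    have j: "j < n" "n - i = Suc j" using Suc.prems by (auto simp: j_def)
    have "commutator_subgroup G (lower_central (G\<lparr>carrier := ?D\<rparr>) i) ?D \<subseteq> S j"
    proof (rule commutator_subgroup_subset)
      show "subgroup (S j) G" using S(3) j by (simp add: normal_imp_subgroup)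
      fix x y assume x: "x \<in> lower_central (G\<lparr>carrier := ?D\<rparr>) i" and y: "y \<in> ?D"
      have "x \<in> S (Suc j)" using x Suc j by auto
      then show "x \<otimes> y \<otimes> inv x \<otimes> inv y \<in> S j"
        using derived_centralizes_cyclic_factor[OF S(3) S(3) S(5) _ y] j by simp
    qed
    then show ?case unfolding lower_central_subgroup_Suc[OF D] j_def .
  qed
  then have "lower_central (G\<lparr>carrier := ?D\<rparr>) n \<subseteq> {\<one>}" using S(1) by force
  moreover have "\<one> \<in> lower_central (G\<lparr>carrier := ?D\<rparr>) n"
    using subgroup.one_closed[OF normal_imp_subgroup[OF D.lower_central_normal[of n]]] by simp
  ultimately show ?thesis by blast
qed

lemma (in group) supersoluble_Mod_imp_lower_central_derived_subset:
  assumes N: "N \<lhd> G" and "supersoluble_group (G Mod N)"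
  shows "\<exists>n. lower_central (G\<lparr>carrier := derived G (carrier G)\<rparr>) n \<subseteq> N"
proof -
  interpret N: normal N G by fact
  interpret Q: group "G Mod N" by (rule N.factorgroup_is_group)
  interpret h: group_hom G "G Mod N" "\<lambda>a. N #> a"
    by unfold_locales (rule N.r_coset_hom_Mod)
  let ?D = "derived G (carrier G)"
  have D: "subgroup ?D G" by (rule derived_is_subgroup) simp
  interpret D: group "G\<lparr>carrier := ?D\<rparr>" by (rule subgroup_imp_group[OF D])
  obtain n where n: "lower_central ((G Mod N)\<lparr>carrier := derived (G Mod N) (carrier (G Mod N))\<rparr>) n
      = {\<one>\<^bsub>G Mod N\<^esub>}"
    using Q.supersoluble_imp_derived_nilpotent[OF assms(2)] by blast
  have "derived (G Mod N) (carrier (G Mod N)) = (\<lambda>a. N #> a) ` ?D"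
    using h.derived_img[of "carrier G"] by (simp add: carrier_FactGroup)
  then have "lower_central ((G Mod N)\<lparr>carrier := (\<lambda>a. N #> a) ` ?D\<rparr>) n = {N}" using n by simp
  then have "(\<lambda>a. N #> a) ` lower_central (G\<lparr>carrier := ?D\<rparr>) n = {N}"
    using group_hom.lower_central_img[OF h.induced_group_hom[OF D]] by simp
  then have "N #> x = N" if "x \<in> lower_central (G\<lparr>carrier := ?D\<rparr>) n" for x
    using that by blast
  moreover have "lower_central (G\<lparr>carrier := ?D\<rparr>) n \<subseteq> carrier G"
    using lower_central_subgroup_subset[OF D] subgroup.subset[OF D] by blast
  ultimately have "lower_central (G\<lparr>carrier := ?D\<rparr>) n \<subseteq> N"
    using coset_join1[OF _ _ N.subgroup_axioms] by (meson subsetD subsetI)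
  then show ?thesis by blast
qed

lemma (in group) prime_chain_imp_cyclic_series:
  assumes fin: "finite (carrier G)" and R: "R \<lhd> G" and "prime_chain G (carrier G) R V"
  shows "\<exists>(S :: nat \<Rightarrow> 'a set) n. S 0 = R \<and> S n = V \<and> (\<forall>i\<le>n. S i \<lhd> G) \<and>
     (\<forall>i<n. S i \<subseteq> S (Suc i) \<and> cyclic_over G (S i) (S (Suc i)))"
  using assms(3)
proof induction
  case start
  show ?case using R by (intro exI[of _ "\<lambda>_. R"] exI[of _ 0]) auto
next
  case (step V Y p)
  obtain S :: "nat \<Rightarrow> 'a set" and n where S: "S 0 = R" "S n = V" "\<forall>i\<le>n. S i \<lhd> G"
    "\<forall>i<n. S i \<subseteq> S (Suc i) \<and> cyclic_over G (S i) (S (Suc i))"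
    using step.IH by blast
  have Y: "Y \<lhd> G" using step.hyps(2,6) by (intro normal_invI)
  have "V \<lhd> G" using S by blast
  then have "cyclic_over G V Y"
    using prime_index_imp_cyclic_over[OF fin] step.hyps by blast
  then show ?case
    using S Y step.hyps(3)
    by (intro exI[of _ "S(Suc n := Y)"] exI[of _ "Suc n"]) (auto simp: less_Suc_eq le_Suc_eq)
qed

lemma (in group) prime_chain_imp_supersoluble_Mod:
  assumes fin: "finite (carrier G)" and R: "R \<lhd> G" and ch: "prime_chain G (carrier G) R (carrier G)"
  shows "supersoluble_group (G Mod R)"
proof -
  interpret R: normal R G by fact
  obtain S :: "nat \<Rightarrow> 'a set" and n where S: "S 0 = R" "S n = carrier G" "\<forall>i\<le>n. S i \<lhd> G"
     "\<forall>i<n. S i \<subseteq> S (Suc i) \<and> cyclic_over G (S i) (S (Suc i))"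
    using prime_chain_imp_cyclic_series[OF fin R ch] by blast
  define h where "h = (\<lambda>a. R #> a)"
  define Q where "Q = G Mod R"
  have Q: "group Q" unfolding Q_def by (rule R.factorgroup_is_group)
  interpret Q: group Q by (rule Q)
  interpret h: group_hom G Q h
    by unfold_locales (simp add: Q_def h_def R.r_coset_hom_Mod)
  have surj: "h ` carrier G = carrier Q" by (simp add: h_def Q_def carrier_FactGroup)
  have norm: "h ` S i \<lhd> Q" if "i \<le> n" for i
  proof (rule Q.normal_invI)
    interpret Si: normal "S i" G using S that by blast
    show "subgroup (h ` S i) Q" by (rule h.subgroup_img_is_subgroup[OF Si.subgroup_axioms])
    fix q y assume "q \<in> carrier Q" "y \<in> h ` S i"
    then obtain g x where g: "g \<in> carrier G" "q = h g" "x \<in> S i" "y = h x" unfolding surj[symmetric] by blast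
    then have "q \<otimes>\<^bsub>Q\<^esub> y \<otimes>\<^bsub>Q\<^esub> inv\<^bsub>Q\<^esub> q = h (g \<otimes> x \<otimes> inv g)" by simp
    moreover have "g \<otimes> x \<otimes> inv g \<in> S i" using Si.inv_op_closed2 g by blast
    ultimately show "q \<otimes>\<^bsub>Q\<^esub> y \<otimes>\<^bsub>Q\<^esub> inv\<^bsub>Q\<^esub> q \<in> h ` S i" by blast
  qed
  have cyc: "cyclic_over Q (h ` S i) (h ` S (Suc i))" if "i < n" for i
  proof -
    interpret Si: normal "S (Suc i)" G using S that by auto
    have "cyclic_over G (S i) (S (Suc i))" using S(4) that by blast
    then obtain x where x: "x \<in> S (Suc i)" "\<forall>y\<in>S (Suc i). \<exists>k::int. y \<otimes> inv (x [^] k) \<in> S i"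
      unfolding cyclic_over_def by blast
    have "\<exists>k::int. h y \<otimes>\<^bsub>Q\<^esub> inv\<^bsub>Q\<^esub> (h x [^]\<^bsub>Q\<^esub> k) \<in> h ` S i" if y: "y \<in> S (Suc i)" for y
    proof -
      obtain k :: int where k: "y \<otimes> inv (x [^] k) \<in> S i" using x y by blast
      have "h (y \<otimes> inv (x [^] k)) = h y \<otimes>\<^bsub>Q\<^esub> inv\<^bsub>Q\<^esub> (h x [^]\<^bsub>Q\<^esub> k)"
        using x y by (simp add: h.hom_int_pow)
      then show ?thesis using k by (metis imageI)
    qed
    then show ?thesis unfolding cyclic_over_def using x(1) by blast
  qed
  have "h x = R" if "x \<in> R" for x
    unfolding h_def using coset_join2[OF _ R.subgroup_axioms that] that by simp
  moreover have "R \<noteq> {}" using R.one_closed by blast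
  ultimately have "h ` R = {\<one>\<^bsub>Q\<^esub>}" by (auto simp: Q_def)
  moreover have "cyclic_group ((Q\<lparr>carrier := h ` S (Suc i)\<rparr>) Mod h ` S i)" if "i < n" for i
    using that S(4) cyc[OF that] norm[of i] normal_imp_subgroup[OF norm[of "Suc i"]]
    by (simp add: Q.cyclic_group_Mod_iff image_mono)
  ultimately show ?thesis
    unfolding supersoluble_group_def Q_def[symmetric] using Q S surj norm
    by (intro conjI exI[of _ "\<lambda>i. h ` S i"] exI[of _ n]) (auto simp: image_mono)
qed

section \<open>A supersoluble quotient of a factorized group\<close>

lemma (in group) normal_of_factorization:
  assumes A: "A \<subseteq> carrier G" and B: "B \<subseteq> carrier G" and car: "carrier G = A <#> B"
    and L: "subgroup L G"
    and normA: "\<And>a y. \<lbrakk>a \<in> A; y \<in> L\<rbrakk> \<Longrightarrow> a \<otimes> y \<otimes> inv a \<in> L"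
    and normB: "\<And>b y. \<lbrakk>b \<in> B; y \<in> L\<rbrakk> \<Longrightarrow> b \<otimes> y \<otimes> inv b \<in> L"
  shows "L \<lhd> G"
proof (rule normal_invI[OF L])
  interpret L: subgroup L G by fact
  fix g y assume "g \<in> carrier G" and y: "y \<in> L"
  then obtain a b where ab: "a \<in> A" "b \<in> B" "g = a \<otimes> b" unfolding car by (auto simp: set_mult_def)
  then have c: "a \<in> carrier G" "b \<in> carrier G" using A B by auto
  have "a \<otimes> (b \<otimes> y \<otimes> inv b) \<otimes> inv a \<in> L" using ab y normA normB by blast
  then show "g \<otimes> y \<otimes> inv g \<in> L" using ab c y by (simp add: m_assoc inv_mult_group)
qed

lemma (in group) commutator_subgroup_of_factors_normal:
  assumes A: "subgroup A G" and B: "subgroup B G" and car: "carrier G = A <#> B"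
  shows "commutator_subgroup G A B \<lhd> G"
proof -
  interpret A: subgroup A G by fact
  interpret B: subgroup B G by fact
  let ?K = "commutator_subgroup G A B"
  have K: "subgroup ?K G" using commutator_subgroup_is_subgroup[OF A.subset B.subset] .
  interpret K: subgroup ?K G by fact
  have conj_K: "g \<otimes> y \<otimes> inv g \<in> ?K"
    if g: "g \<in> carrier G" and y: "y \<in> ?K"
      and gen: "\<And>a b. \<lbrakk>a \<in> A; b \<in> B\<rbrakk> \<Longrightarrow> g \<otimes> (a \<otimes> b \<otimes> inv a \<otimes> inv b) \<otimes> inv g \<in> ?K" for g y
  proof -
    have hom: "group_hom G G (\<lambda>x. g \<otimes> x \<otimes> inv g)"
      using g by unfold_locales (auto simp: hom_def m_assoc inv_solve_left)
    have "commutator_subgroup G A B \<subseteq> {y \<in> carrier G. g \<otimes> y \<otimes> inv g \<in> ?K}"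
    proof (rule commutator_subgroup_subset)
      show "subgroup {y \<in> carrier G. g \<otimes> y \<otimes> inv g \<in> ?K} G"
      proof (rule subgroupI)
        interpret c: group_hom G G "\<lambda>x. g \<otimes> x \<otimes> inv g" by (rule hom)
        have "\<one> \<in> {y \<in> carrier G. g \<otimes> y \<otimes> inv g \<in> ?K}" using g by simp
        then show "{y \<in> carrier G. g \<otimes> y \<otimes> inv g \<in> ?K} \<noteq> {}" by blast
        show "inv x \<in> {y \<in> carrier G. g \<otimes> y \<otimes> inv g \<in> ?K}"
          if "x \<in> {y \<in> carrier G. g \<otimes> y \<otimes> inv g \<in> ?K}" for x
          using that c.hom_inv[of x] by auto
        show "x \<otimes> y \<in> {y \<in> carrier G. g \<otimes> y \<otimes> inv g \<in> ?K}"
          if "x \<in> {y \<in> carrier G. g \<otimes> y \<otimes> inv g \<in> ?K}"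
            "y \<in> {y \<in> carrier G. g \<otimes> y \<otimes> inv g \<in> ?K}" for x y
          using that c.hom_mult[of x y] by auto
      qed auto
      fix a b assume "a \<in> A" "b \<in> B"
      then show "a \<otimes> b \<otimes> inv a \<otimes> inv b \<in> {y \<in> carrier G. g \<otimes> y \<otimes> inv g \<in> ?K}"
        using gen by simp
    qed
    then show ?thesis using y by blast
  qed
  show ?thesis
  proof (rule normal_of_factorization[OF A.subset B.subset car K])
    fix a y assume a: "a \<in> A" and y: "y \<in> ?K"
    show "a \<otimes> y \<otimes> inv a \<in> ?K"
    proof (rule conj_K[OF A.mem_carrier[OF a] y])
      fix a' b assume ab: "a' \<in> A" "b \<in> B"
      \<comment> \<open>\<open>[a a', b] = a [a', b] a\<inverse> [a, b]\<close>\<close>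
      have "(a \<otimes> a') \<otimes> b \<otimes> inv (a \<otimes> a') \<otimes> inv b \<otimes> inv (a \<otimes> b \<otimes> inv a \<otimes> inv b) \<in> ?K"
        using a ab by (intro K.m_closed K.m_inv_closed commutator_mem) auto
      moreover have "(a \<otimes> a') \<otimes> b \<otimes> inv (a \<otimes> a') \<otimes> inv b \<otimes> inv (a \<otimes> b \<otimes> inv a \<otimes> inv b)
          = a \<otimes> (a' \<otimes> b \<otimes> inv a' \<otimes> inv b) \<otimes> inv a"
        using a ab by (simp add: m_assoc inv_mult_group inv_cancel_left)
      ultimately show "a \<otimes> (a' \<otimes> b \<otimes> inv a' \<otimes> inv b) \<otimes> inv a \<in> ?K" by simp
    qed
  next
    fix b y assume b: "b \<in> B" and y: "y \<in> ?K"
    show "b \<otimes> y \<otimes> inv b \<in> ?K"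
    proof (rule conj_K[OF B.mem_carrier[OF b] y])
      fix a b' assume ab: "a \<in> A" "b' \<in> B"
      \<comment> \<open>\<open>[a, b b'] = [a, b] b [a, b'] b\<inverse>\<close>\<close>
      have "inv (a \<otimes> b \<otimes> inv a \<otimes> inv b) \<otimes> (a \<otimes> (b \<otimes> b') \<otimes> inv a \<otimes> inv (b \<otimes> b')) \<in> ?K"
        using b ab by (intro K.m_closed K.m_inv_closed commutator_mem) auto
      moreover have "inv (a \<otimes> b \<otimes> inv a \<otimes> inv b) \<otimes> (a \<otimes> (b \<otimes> b') \<otimes> inv a \<otimes> inv (b \<otimes> b'))
          = b \<otimes> (a \<otimes> b' \<otimes> inv a \<otimes> inv b') \<otimes> inv b"
        using b ab by (simp add: m_assoc inv_mult_group inv_cancel_left)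
      ultimately show "b \<otimes> (a \<otimes> b' \<otimes> inv a \<otimes> inv b') \<otimes> inv b \<in> ?K" by simp
    qed
  qed
qed

text \<open>
  If \<open>[A,B] \<subseteq> M\<close>, every subgroup between \<open>M\<close> and \<open>M A\<close> is normalized by \<open>B\<close>. When \<open>A \<subseteq> M\<close>, this
  gives nothing above \<open>M\<close>, but then every subgroup containing \<open>M\<close> is normalized by \<open>A\<close>.
\<close>
lemma (in group) prime_step_of_central_product:
  assumes fin: "finite (carrier G)" and A: "subgroup A G" and B: "subgroup B G"
    and car: "carrier G = A <#> B"
    and M: "M \<lhd> G" "M \<noteq> carrier G" and KM: "commutator_subgroup G A B \<subseteq> M"
    and chA: "prime_chain G A M (carrier G)" and chB: "prime_chain G B M (carrier G)"
  shows "\<exists>L p. L \<lhd> G \<and> M \<subseteq> L \<and> Factorial_Ring.prime p \<and> card L = p * card M"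
proof -
  interpret A: subgroup A G by fact
  interpret B: subgroup B G by fact
  interpret M: normal M G by fact
  have GG: "carrier G \<lhd> G" by (rule normal_invI[OF subgroup_self]) simp
  show ?thesis
  proof (cases "A \<subseteq> M")
    case True
    have "carrier G \<inter> carrier G \<noteq> M" using M(2) by simp
    from prime_chain_meets[OF chB fin M(1) GG M.subset B.subset this]
    obtain L p where L: "subgroup L G" "M \<subseteq> L" "Factorial_Ring.prime p" "card L = p * card M"
      "\<forall>b\<in>B. \<forall>y\<in>L. b \<otimes> y \<otimes> inv b \<in> L" by blast
    interpret L: subgroup L G by fact
    have "L \<lhd> G"
      using True L(2,5) by (intro normal_of_factorization[OF A.subset B.subset car L(1)]) auto
    then show ?thesis using L by blast
  next
    case False
    define N where "N = M <#> A"
    have Nsub: "subgroup N G" unfolding N_def by (rule mult_norm_subgroup[OF M(1) A])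
    interpret N: subgroup N G by fact
    have AN: "a \<in> N" if "a \<in> A" for a
      unfolding N_def using that by (auto intro: set_mult_memI[OF M.one_closed that])
    have MN: "M \<subseteq> N"
      unfolding N_def by (auto intro: set_mult_memI[OF _ A.one_closed])
    \<comment> \<open>Modulo \<open>M\<close>, the factor \<open>B\<close> centralizes \<open>A\<close>.\<close>
    have comm: "b \<otimes> y \<otimes> inv b \<otimes> inv y \<in> M" if b: "b \<in> B" and y: "y \<in> N" for b y
    proof -
      obtain m a where ma: "m \<in> M" "a \<in> A" "y = m \<otimes> a" using y by (auto simp: N_def set_mult_def)
      note c = M.mem_carrier[OF ma(1)] A.mem_carrier[OF ma(2)] B.mem_carrier[OF b]
      have "a \<otimes> b \<otimes> inv a \<otimes> inv b \<in> M" using KM commutator_mem[OF ma(2) b] by blast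
      then have "inv (a \<otimes> b \<otimes> inv a \<otimes> inv b) \<in> M" by (rule M.m_inv_closed)
      then have "(b \<otimes> m \<otimes> inv b) \<otimes> inv (a \<otimes> b \<otimes> inv a \<otimes> inv b) \<otimes> inv m \<in> M"
        by (rule M.m_closed[OF M.m_closed[OF M.inv_op_closed2[OF c(3) ma(1)]] M.m_inv_closed[OF ma(1)]])
      moreover have "(b \<otimes> m \<otimes> inv b) \<otimes> inv (a \<otimes> b \<otimes> inv a \<otimes> inv b) \<otimes> inv m
          = b \<otimes> y \<otimes> inv b \<otimes> inv y"
        using c by (simp add: ma(3) m_assoc inv_mult_group inv_cancel_left)
      ultimately show ?thesis by simp
    qed
    have normB: "b \<otimes> y \<otimes> inv b \<in> L" if "subgroup L G" "M \<subseteq> L" "L \<subseteq> N" "b \<in> B" "y \<in> L" for L b y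
    proof -
      have "(b \<otimes> y \<otimes> inv b \<otimes> inv y) \<otimes> y \<in> L"
        by (rule subgroup.m_closed[OF that(1) subsetD[OF that(2) comm[OF that(4) subsetD[OF that(3,5)]]] that(5)])
      moreover have "y \<in> carrier G" by (rule subgroup.mem_carrier[OF that(1,5)])
      ultimately show ?thesis using that(4) by (simp add: m_assoc)
    qed
    have "N \<lhd> G"
      using normB[OF Nsub MN order.refl] AN
      by (intro normal_of_factorization[OF A.subset B.subset car Nsub]) auto
    moreover have "N \<inter> carrier G \<noteq> M" using AN False N.subset by blast
    ultimately obtain L p where L: "subgroup L G" "M \<subseteq> L" "L \<subseteq> N" "Factorial_Ring.prime p"
      "card L = p * card M" "\<forall>a\<in>A. \<forall>y\<in>L. a \<otimes> y \<otimes> inv a \<in> L"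
      using prime_chain_meets[OF chA fin M(1) _ MN A.subset] by blast
    have "L \<lhd> G"
      using L(6) normB[OF L(1-3)]
      by (intro normal_of_factorization[OF A.subset B.subset car L(1)]) auto
    then show ?thesis using L by blast
  qed
qed

text \<open>
  The assumptions on \<open>N\<close> say that \<open>N / M\<close> is abelian and centralized by \<open>[A,B]\<close>, so that \<open>A\<close> and
  \<open>B\<close> commute in their action on \<open>N / M\<close>.
\<close>
lemma (in group) prime_step_of_centralized_factor:
  assumes fin: "finite (carrier G)" and A: "subgroup A G" and B: "subgroup B G"
    and car: "carrier G = A <#> B"
    and M: "M \<lhd> G" and N: "N \<lhd> G" and MN: "M \<subset> N"
    and centK: "\<And>y k. \<lbrakk>y \<in> N; k \<in> commutator_subgroup G A B\<rbrakk> \<Longrightarrow> y \<otimes> k \<otimes> inv y \<otimes> inv k \<in> M"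
    and abel: "\<And>y z. \<lbrakk>y \<in> N; z \<in> N\<rbrakk> \<Longrightarrow> y \<otimes> z \<otimes> inv y \<otimes> inv z \<in> M"
    and chA: "prime_chain G A M (carrier G)" and chB: "prime_chain G B M (carrier G)"
  shows "\<exists>L p. L \<lhd> G \<and> M \<subseteq> L \<and> Factorial_Ring.prime p \<and> card L = p * card M"
proof -
  interpret A: subgroup A G by fact
  interpret B: subgroup B G by fact
  interpret M: normal M G by fact
  interpret N: normal N G by fact
  let ?K = "commutator_subgroup G A B"
  have Kc: "?K \<subseteq> carrier G"
    using commutator_subgroup_is_subgroup[OF A.subset B.subset] subgroup.subset by blast
  obtain H :: "'a set monoid" and h where hom: "group_hom G H h"
    and h: "\<And>x y. \<lbrakk>x \<in> carrier G; y \<in> carrier G\<rbrakk> \<Longrightarrow> h x = h y \<longleftrightarrow> x \<otimes> inv y \<in> M"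
    using quotient_map[OF M] by blast
  interpret h: group_hom G H h by fact
  have commH: "h x \<otimes>\<^bsub>H\<^esub> h y = h y \<otimes>\<^bsub>H\<^esub> h x"
    if "x \<otimes> y \<otimes> inv x \<otimes> inv y \<in> M" "x \<in> carrier G" "y \<in> carrier G" for x y
  proof -
    have "(x \<otimes> y) \<otimes> inv (y \<otimes> x) \<in> M" using that by (simp add: inv_mult_group m_assoc)
    then have "h (x \<otimes> y) = h (y \<otimes> x)" using that(2,3) by (intro iffD2[OF h]) auto
    then show ?thesis using that(2,3) by simp
  qed
  have commN: "h x \<otimes>\<^bsub>H\<^esub> h y = h y \<otimes>\<^bsub>H\<^esub> h x" if "x \<in> N" "y \<in> N" for x y
    by (rule commH[OF abel[OF that] N.mem_carrier[OF that(1)] N.mem_carrier[OF that(2)]])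
  have "N \<inter> carrier G \<noteq> M" using MN N.subset by blast
  then obtain L p where L: "subgroup L G" "M \<subseteq> L" "L \<subseteq> N" "Factorial_Ring.prime p"
      "card L = p * card M" "\<forall>a\<in>A. \<forall>y\<in>L. a \<otimes> y \<otimes> inv a \<in> L"
    using prime_chain_meets[OF chA fin M N _ A.subset] MN by blast
  have cycL: "cyclic_over G M L" by (rule prime_index_imp_cyclic_over[OF fin M L(1,2,4,5)])
  have "\<forall>a\<in>A. \<exists>l::int. \<forall>y\<in>L. h (a \<otimes> y \<otimes> inv a) = h y [^]\<^bsub>H\<^esub> l"
  proof
    fix a assume a: "a \<in> A"
    obtain l :: int where l: "\<forall>y\<in>L. (a \<otimes> y \<otimes> inv a) \<otimes> inv (y [^] l) \<in> M"
      using cyclic_over_conj_pow[OF M L(1) cycL A.mem_carrier[OF a]] L(6) a by blast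
    have "h (a \<otimes> y \<otimes> inv a) = h y [^]\<^bsub>H\<^esub> l" if y: "y \<in> L" for y
    proof -
      have yc: "y \<in> carrier G" by (rule subgroup.mem_carrier[OF L(1) y])
      have "h (a \<otimes> y \<otimes> inv a) = h (y [^] l)"
        using bspec[OF l y] yc a by (intro iffD2[OF h]) auto
      then show ?thesis using yc by (simp add: h.hom_int_pow)
    qed
    then show "\<exists>l::int. \<forall>y\<in>L. h (a \<otimes> y \<otimes> inv a) = h y [^]\<^bsub>H\<^esub> l" by blast
  qed
  then obtain l :: "'a \<Rightarrow> int" where
    l: "\<And>a y. \<lbrakk>a \<in> A; y \<in> L\<rbrakk> \<Longrightarrow> h (a \<otimes> y \<otimes> inv a) = h y [^]\<^bsub>H\<^esub> l a"
    by metis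
  \<comment> \<open>The part of \<open>N\<close> on which every \<open>a \<in> A\<close> acts, modulo \<open>M\<close>, with the same exponent \<open>l a\<close>
      as on \<open>L\<close>.\<close>
  define W where "W = {y \<in> N. \<forall>a\<in>A. h a \<otimes>\<^bsub>H\<^esub> h y \<otimes>\<^bsub>H\<^esub> inv\<^bsub>H\<^esub> h a = h y [^]\<^bsub>H\<^esub> l a}"
  have conj_mult: "c \<otimes>\<^bsub>H\<^esub> (x \<otimes>\<^bsub>H\<^esub> y) \<otimes>\<^bsub>H\<^esub> inv\<^bsub>H\<^esub> c
      = (c \<otimes>\<^bsub>H\<^esub> x \<otimes>\<^bsub>H\<^esub> inv\<^bsub>H\<^esub> c) \<otimes>\<^bsub>H\<^esub> (c \<otimes>\<^bsub>H\<^esub> y \<otimes>\<^bsub>H\<^esub> inv\<^bsub>H\<^esub> c)"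
    if "c \<in> carrier H" "x \<in> carrier H" "y \<in> carrier H" for c x y
    using that by (simp add: h.H.m_assoc h.H.inv_solve_left)
  have Wsub: "subgroup W G"
  proof (rule subgroupI)
    show "W \<subseteq> carrier G" by (auto simp: W_def)
    have "\<one> \<in> W" using A.mem_carrier by (simp add: W_def)
    then show "W \<noteq> {}" by blast
  next
    fix y assume "y \<in> W"
    then have y: "y \<in> N" "\<And>a. a \<in> A \<Longrightarrow> h a \<otimes>\<^bsub>H\<^esub> h y \<otimes>\<^bsub>H\<^esub> inv\<^bsub>H\<^esub> h a = h y [^]\<^bsub>H\<^esub> l a"
      by (auto simp: W_def)
    have "h a \<otimes>\<^bsub>H\<^esub> h (inv y) \<otimes>\<^bsub>H\<^esub> inv\<^bsub>H\<^esub> h a = h (inv y) [^]\<^bsub>H\<^esub> l a" if a: "a \<in> A" for a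
    proof -
      have c: "h y \<in> carrier H" "h a \<in> carrier H" using y(1) a by auto
      have "h a \<otimes>\<^bsub>H\<^esub> inv\<^bsub>H\<^esub> h y \<otimes>\<^bsub>H\<^esub> inv\<^bsub>H\<^esub> h a = inv\<^bsub>H\<^esub> (h a \<otimes>\<^bsub>H\<^esub> h y \<otimes>\<^bsub>H\<^esub> inv\<^bsub>H\<^esub> h a)"
        using c by (simp add: h.H.inv_mult_group h.H.m_assoc)
      also have "\<dots> = (inv\<^bsub>H\<^esub> h y) [^]\<^bsub>H\<^esub> l a"
        using c by (simp add: y(2)[OF a] h.H.int_pow_inv)
      finally show ?thesis using y(1) by simp
    qed
    then show "inv y \<in> W" using y(1) unfolding W_def by blast
  next
    fix x y assume "x \<in> W" "y \<in> W"
    then have x: "x \<in> N" "\<And>a. a \<in> A \<Longrightarrow> h a \<otimes>\<^bsub>H\<^esub> h x \<otimes>\<^bsub>H\<^esub> inv\<^bsub>H\<^esub> h a = h x [^]\<^bsub>H\<^esub> l a"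
      and y: "y \<in> N" "\<And>a. a \<in> A \<Longrightarrow> h a \<otimes>\<^bsub>H\<^esub> h y \<otimes>\<^bsub>H\<^esub> inv\<^bsub>H\<^esub> h a = h y [^]\<^bsub>H\<^esub> l a"
      by (auto simp: W_def)
    have "h a \<otimes>\<^bsub>H\<^esub> h (x \<otimes> y) \<otimes>\<^bsub>H\<^esub> inv\<^bsub>H\<^esub> h a = h (x \<otimes> y) [^]\<^bsub>H\<^esub> l a" if a: "a \<in> A" for a
      using x(1) y(1) a conj_mult[of "h a" "h x" "h y"]
        h.H.int_pow_mult_distrib[OF commN[OF x(1) y(1)]]
      by (simp add: x(2) y(2))
    then show "x \<otimes> y \<in> W" using x(1) y(1) unfolding W_def by blast
  qed
  have LW: "L \<subseteq> W"
  proof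
    fix y assume y: "y \<in> L"
    then have "y \<in> N" using L(3) by blast
    moreover have "h a \<otimes>\<^bsub>H\<^esub> h y \<otimes>\<^bsub>H\<^esub> inv\<^bsub>H\<^esub> h a = h y [^]\<^bsub>H\<^esub> l a" if "a \<in> A" for a
      using l[OF that y] that \<open>y \<in> N\<close> by simp
    ultimately show "y \<in> W" unfolding W_def by blast
  qed
  have W: "W \<lhd> G"
  proof (rule normal_of_factorization[OF A.subset B.subset car Wsub])
    fix a y assume a: "a \<in> A" and "y \<in> W"
    then have y: "y \<in> N" "\<And>a. a \<in> A \<Longrightarrow> h a \<otimes>\<^bsub>H\<^esub> h y \<otimes>\<^bsub>H\<^esub> inv\<^bsub>H\<^esub> h a = h y [^]\<^bsub>H\<^esub> l a"
      by (auto simp: W_def)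
    have hy: "h y \<in> carrier H" using y(1) by simp
    have ha: "h (a \<otimes> y \<otimes> inv a) = h y [^]\<^bsub>H\<^esub> l a" using a y by simp
    have "h a' \<otimes>\<^bsub>H\<^esub> h (a \<otimes> y \<otimes> inv a) \<otimes>\<^bsub>H\<^esub> inv\<^bsub>H\<^esub> h a' = h (a \<otimes> y \<otimes> inv a) [^]\<^bsub>H\<^esub> l a'"
      if a': "a' \<in> A" for a'
    proof -
      have "h a' \<otimes>\<^bsub>H\<^esub> (h y [^]\<^bsub>H\<^esub> l a) \<otimes>\<^bsub>H\<^esub> inv\<^bsub>H\<^esub> h a'
          = (h a' \<otimes>\<^bsub>H\<^esub> h y \<otimes>\<^bsub>H\<^esub> inv\<^bsub>H\<^esub> h a') [^]\<^bsub>H\<^esub> l a"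
        using h.H.int_pow_conj[of "h a'" "h y" "l a"] hy a' by simp
      also have "\<dots> = (h y [^]\<^bsub>H\<^esub> l a) [^]\<^bsub>H\<^esub> l a'"
        using hy by (simp add: y(2)[OF a'] h.H.int_pow_pow mult.commute)
      finally show ?thesis by (simp only: ha)
    qed
    then show "a \<otimes> y \<otimes> inv a \<in> W"
      using N.inv_op_closed2[OF A.mem_carrier[OF a] y(1)] unfolding W_def by blast
  next
    fix b y assume b: "b \<in> B" and "y \<in> W"
    then have y: "y \<in> N" "\<And>a. a \<in> A \<Longrightarrow> h a \<otimes>\<^bsub>H\<^esub> h y \<otimes>\<^bsub>H\<^esub> inv\<^bsub>H\<^esub> h a = h y [^]\<^bsub>H\<^esub> l a"
      by (auto simp: W_def)
    have bc: "b \<in> carrier G" "y \<in> carrier G" using b y(1) by auto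
    have "h a \<otimes>\<^bsub>H\<^esub> h (b \<otimes> y \<otimes> inv b) \<otimes>\<^bsub>H\<^esub> inv\<^bsub>H\<^esub> h a = h (b \<otimes> y \<otimes> inv b) [^]\<^bsub>H\<^esub> l a"
      if a: "a \<in> A" for a
    proof -
      have ac: "a \<in> carrier G" using a by simp
      \<comment> \<open>\<open>a b = c b a\<close> with \<open>c = [a, b]\<close>, and \<open>c\<close> centralizes \<open>N\<close> modulo \<open>M\<close>.\<close>
      define c where "c = a \<otimes> b \<otimes> inv a \<otimes> inv b"
      define y' where "y' = (b \<otimes> a) \<otimes> y \<otimes> inv (b \<otimes> a)"
      have cK: "c \<in> ?K" unfolding c_def by (rule commutator_mem[OF a b])
      have cc: "c \<in> carrier G" using cK Kc by blast
      have y'N: "y' \<in> N" unfolding y'_def using ac bc y(1) by (intro N.inv_op_closed2) auto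
      have y'c: "y' \<in> carrier G" using y'N by simp
      have "a \<otimes> (b \<otimes> y \<otimes> inv b) \<otimes> inv a = c \<otimes> y' \<otimes> inv c"
        using ac bc by (simp add: c_def y'_def m_assoc inv_mult_group inv_cancel_left)
      moreover have "h (c \<otimes> y' \<otimes> inv c) = h y'"
      proof -
        have "h y' \<otimes>\<^bsub>H\<^esub> h c = h c \<otimes>\<^bsub>H\<^esub> h y'" using commH[OF centK[OF y'N cK] y'c cc] .
        then have "h (c \<otimes> y' \<otimes> inv c) = (h y' \<otimes>\<^bsub>H\<^esub> h c) \<otimes>\<^bsub>H\<^esub> inv\<^bsub>H\<^esub> h c"
          using cc y'c by simp
        then show ?thesis using cc y'c by (simp add: h.H.m_assoc)
      qed
      moreover have "h y' = h b \<otimes>\<^bsub>H\<^esub> (h a \<otimes>\<^bsub>H\<^esub> h y \<otimes>\<^bsub>H\<^esub> inv\<^bsub>H\<^esub> h a) \<otimes>\<^bsub>H\<^esub> inv\<^bsub>H\<^esub> h b"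
        using ac bc by (simp add: y'_def h.H.m_assoc h.H.inv_mult_group)
      moreover have "\<dots> = (h b \<otimes>\<^bsub>H\<^esub> h y \<otimes>\<^bsub>H\<^esub> inv\<^bsub>H\<^esub> h b) [^]\<^bsub>H\<^esub> l a"
        using bc by (simp add: y(2)[OF a] h.H.int_pow_conj)
      ultimately have "h (a \<otimes> (b \<otimes> y \<otimes> inv b) \<otimes> inv a) = (h b \<otimes>\<^bsub>H\<^esub> h y \<otimes>\<^bsub>H\<^esub> inv\<^bsub>H\<^esub> h b) [^]\<^bsub>H\<^esub> l a"
        by simp
      then show ?thesis using ac bc by simp
    qed
    then show "b \<otimes> y \<otimes> inv b \<in> W"
      using N.inv_op_closed2[OF bc(1) y(1)] unfolding W_def by blast
  qed
  interpret W: normal W G by (rule W)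
  have finM: "finite M" using fin M.subset by (rule rev_finite_subset)
  have "M \<noteq> {}" using M.one_closed by blast
  then have "card M < card L" using L(4,5) finM prime_gt_1_nat[of p] by (simp add: card_gt_0_iff)
  then have "M \<subset> L" using L(2) by auto
  then have MW: "M \<subseteq> W" "W \<inter> carrier G \<noteq> M" using LW W.subset by blast+
  obtain P q where P: "subgroup P G" "M \<subseteq> P" "P \<subseteq> W" "Factorial_Ring.prime q"
      "card P = q * card M" "\<forall>b\<in>B. \<forall>y\<in>P. b \<otimes> y \<otimes> inv b \<in> P"
    using prime_chain_meets[OF chB fin M W MW(1) B.subset MW(2)] by blast
  have "P \<lhd> G"
  proof (rule normal_of_factorization[OF A.subset B.subset car P(1)])
    fix a y assume a: "a \<in> A" and y: "y \<in> P"
    have "y \<in> W" using y P(3) by blast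
    then have yN: "y \<in> N" "h a \<otimes>\<^bsub>H\<^esub> h y \<otimes>\<^bsub>H\<^esub> inv\<^bsub>H\<^esub> h a = h y [^]\<^bsub>H\<^esub> l a"
      using a by (auto simp: W_def)
    have c: "a \<in> carrier G" "y \<in> carrier G" using a yN by auto
    have "h (a \<otimes> y \<otimes> inv a) = h (y [^] l a)"
      using yN(2) c by (simp add: h.hom_int_pow)
    then have "(a \<otimes> y \<otimes> inv a) \<otimes> inv (y [^] l a) \<in> M"
      using c by (intro iffD1[OF h]) auto
    moreover have "y [^] l a \<in> P" by (rule subgroup_int_pow_closed[OF P(1) y])
    ultimately have "(a \<otimes> y \<otimes> inv a) \<otimes> inv (y [^] l a) \<otimes> y [^] l a \<in> P"
      by (rule subgroup.m_closed[OF P(1) subsetD[OF P(2)]])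
    then show "a \<otimes> y \<otimes> inv a \<in> P" using c by (simp add: m_assoc)
  qed (use P(6) in blast)
  then show ?thesis using P by blast
qed

text \<open>
  The assumption \<open>nil\<close> says that the image of \<open>[A,B]\<close> in \<open>G / M\<close> is nilpotent. Unless that image is
  trivial, the last nontrivial term of its lower central series is central in it.
\<close>
lemma (in group) prime_step_of_nilpotent_commutator:
  assumes fin: "finite (carrier G)" and A: "subgroup A G" and B: "subgroup B G"
    and car: "carrier G = A <#> B"
    and M: "M \<lhd> G" "M \<noteq> carrier G"
    and nil: "lower_central (G\<lparr>carrier := commutator_subgroup G A B\<rparr>) n \<subseteq> M"
    and chA: "prime_chain G A M (carrier G)" and chB: "prime_chain G B M (carrier G)"
  shows "\<exists>L p. L \<lhd> G \<and> M \<subseteq> L \<and> Factorial_Ring.prime p \<and> card L = p * card M"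
proof -
  let ?K = "commutator_subgroup G A B"
  define C where "C = lower_central (G\<lparr>carrier := ?K\<rparr>)"
  have K: "?K \<lhd> G" by (rule commutator_subgroup_of_factors_normal[OF A B car])
  interpret K: normal ?K G by (rule K)
  interpret M: normal M G by fact
  show ?thesis
  proof (cases "?K \<subseteq> M")
    case True
    then show ?thesis using prime_step_of_central_product[OF fin A B car M True chA chB] by blast
  next
    case False
    define m where "m = (LEAST n. C n \<subseteq> M)"
    have m: "C m \<subseteq> M" unfolding m_def by (rule LeastI[of _ n]) (use nil in \<open>simp add: C_def\<close>)
    have "m \<noteq> 0" using m False by (auto simp: C_def)
    then obtain i where i: "m = Suc i" by (cases m) auto
    have Ci: "\<not> C i \<subseteq> M" using not_less_Least[of i "\<lambda>n. C n \<subseteq> M"] i unfolding m_def by simp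
    have CiN: "C i \<lhd> G" unfolding C_def by (rule lower_central_of_normal_subgroup[OF K])
    interpret C: normal "C i" G by (rule CiN)
    have CK: "C i \<subseteq> ?K" unfolding C_def by (rule lower_central_subgroup_subset[OF K.subgroup_axioms])
    have cent: "c \<otimes> k \<otimes> inv c \<otimes> inv k \<in> M" if "c \<in> C i" "k \<in> ?K" for c k
      using m commutator_mem[OF that] lower_central_subgroup_Suc[OF K.subgroup_axioms, of i]
      unfolding i C_def by blast
    define N where "N = M <#> C i"
    have N: "N \<lhd> G" unfolding N_def by (rule normal_subgroup_set_mult_closed[OF M(1) CiN])
    have "M \<subseteq> N" unfolding N_def by (auto intro: set_mult_memI[OF _ C.one_closed])
    moreover have "C i \<subseteq> N" unfolding N_def by (auto intro: set_mult_memI[OF M.one_closed])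
    ultimately have MN: "M \<subset> N" using Ci by blast
    have comm: "y \<otimes> x \<otimes> inv y \<otimes> inv x \<in> M"
      if y: "y \<in> N" and x: "x \<in> M <#> ?K" for y x
    proof -
      obtain H :: "'a set monoid" and h where hom: "group_hom G H h"
        and h: "\<And>x y. \<lbrakk>x \<in> carrier G; y \<in> carrier G\<rbrakk> \<Longrightarrow> h x = h y \<longleftrightarrow> x \<otimes> inv y \<in> M"
        using quotient_map[OF M(1)] by blast
      interpret h: group_hom G H h by fact
      have hM: "h (u \<otimes> v) = h v" if "u \<in> M" "v \<in> carrier G" for u v
        using h[of "u \<otimes> v" v] that by (simp add: m_assoc)
      obtain u c where uc: "u \<in> M" "c \<in> C i" "y = u \<otimes> c" using y by (auto simp: N_def set_mult_def)
      obtain v k where vk: "v \<in> M" "k \<in> ?K" "x = v \<otimes> k" using x by (auto simp: set_mult_def)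
      have yx: "y \<in> carrier G" "x \<in> carrier G" "c \<in> carrier G" "k \<in> carrier G" using uc vk by auto
      have "(c \<otimes> k) \<otimes> inv (k \<otimes> c) \<in> M"
        using cent[OF uc(2) vk(2)] yx by (simp add: inv_mult_group m_assoc)
      then have "h (c \<otimes> k) = h (k \<otimes> c)" using yx by (intro iffD2[OF h]) auto
      moreover have "h y = h c" "h x = h k" using uc vk hM yx by auto
      ultimately have "h (y \<otimes> x) = h (x \<otimes> y)" using yx by simp
      then have "(y \<otimes> x) \<otimes> inv (x \<otimes> y) \<in> M" using yx by (intro iffD1[OF h]) auto
      then show ?thesis using yx by (simp add: inv_mult_group m_assoc)
    qed
    have "?K \<subseteq> M <#> ?K" by (auto intro: set_mult_memI[OF M.one_closed])
    moreover have "N \<subseteq> M <#> ?K" unfolding N_def using CK by (intro mono_set_mult) auto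
    ultimately show ?thesis
      using prime_step_of_centralized_factor[OF fin A B car M(1) N MN comm comm chA chB] by blast
  qed
qed

lemma (in group) supersoluble_Mod_of_nilpotent_commutator:
  assumes fin: "finite (carrier G)" and A: "subgroup A G" and B: "subgroup B G"
    and car: "carrier G = A <#> B" and R: "R \<lhd> G"
    and nil: "lower_central (G\<lparr>carrier := commutator_subgroup G A B\<rparr>) n \<subseteq> R"
    and chA: "\<And>M. M \<lhd> G \<Longrightarrow> prime_chain G A M (carrier G)"
    and chB: "\<And>M. M \<lhd> G \<Longrightarrow> prime_chain G B M (carrier G)"
  shows "supersoluble_group (G Mod R)"
proof -
  have "prime_chain G (carrier G) R (carrier G)"
    if "M \<lhd> G" "R \<subseteq> M" "prime_chain G (carrier G) R M" for M
    using that
  proof (induction "card (carrier G) - card M" arbitrary: M rule: less_induct)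
    case less
    interpret M: normal M G by fact
    show ?case
    proof (cases "M = carrier G")
      case False
      have "lower_central (G\<lparr>carrier := commutator_subgroup G A B\<rparr>) n \<subseteq> M"
        using nil less.prems(2) by blast
      from prime_step_of_nilpotent_commutator[OF fin A B car less.prems(1) False this
          chA[OF less.prems(1)] chB[OF less.prems(1)]]
      obtain L p where L: "L \<lhd> G" "M \<subseteq> L" "Factorial_Ring.prime p" "card L = p * card M"
        by blast
      interpret L: normal L G by (rule L(1))
      have finM: "finite M" using fin M.subset by (rule rev_finite_subset)
      have "M \<noteq> {}" using M.one_closed by blast
      then have "card M < card L" using L(3,4) finM prime_gt_1_nat[of p] by (simp add: card_gt_0_iff)
      moreover have "card L \<le> card (carrier G)" using fin L.subset by (rule card_mono)
      ultimately have lt: "card (carrier G) - card L < card (carrier G) - card M" by simp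
      have "prime_chain G (carrier G) R L"
        using less.prems(3) L.subgroup_axioms L(2-4) by (rule prime_chain.step) (rule L.inv_op_closed2)
      then show ?thesis using less.hyps[OF lt L(1)] less.prems(2) L(2) by blast
    qed (use less in simp)
  qed
  from this[OF R order.refl prime_chain.start] show ?thesis
    by (rule prime_chain_imp_supersoluble_Mod[OF fin R])
qed

section \<open>The residuals of a mutually permutable product\<close>
theorem theorem1:
  fixes G :: "('a, 'b) monoid_scheme" and A B :: "'a set"
  assumes "group G" and "finite (carrier G)"
    and "subgroup A G" and "subgroup B G"
    and "supersoluble_group (G\<lparr>carrier := A\<rparr>)" and "supersoluble_group (G\<lparr>carrier := B\<rparr>)"
    and "mutually_permutable_product G A B"
  shows "residual supersoluble_group G
           = residual nilpotent_group (G\<lparr>carrier := derived G (carrier G)\<rparr>)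
         \<and> residual nilpotent_group (G\<lparr>carrier := derived G (carrier G)\<rparr>)
           = residual nilpotent_group (G\<lparr>carrier := commutator_subgroup G A B\<rparr>)"
proof -
  interpret group G by fact
  note fin = assms(2) and A = assms(3) and B = assms(4)
  have car: "carrier G = A <#>\<^bsub>G\<^esub> B"
    and permA: "\<And>U. \<lbrakk>subgroup U G; U \<subseteq> A\<rbrakk> \<Longrightarrow> B <#>\<^bsub>G\<^esub> U = U <#>\<^bsub>G\<^esub> B"
    and permB: "\<And>V. \<lbrakk>subgroup V G; V \<subseteq> B\<rbrakk> \<Longrightarrow> A <#>\<^bsub>G\<^esub> V = V <#>\<^bsub>G\<^esub> A"
    using assms(7) unfolding mutually_permutable_product_def by auto
  have car': "carrier G = B <#>\<^bsub>G\<^esub> A" using car permA[OF A order.refl] by simp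
  note chains = supersoluble_subgroup_imp_prime_chain[OF fin A assms(5)]
    supersoluble_subgroup_imp_prime_chain[OF fin B assms(6)]
  have chA: "prime_chain G A M (carrier G)" if "M \<lhd> G" for M
    by (rule prime_chain_of_factorization[OF fin A B car permB chains that])
  have chB: "prime_chain G B M (carrier G)" if "M \<lhd> G" for M
    by (rule prime_chain_of_factorization[OF fin B A car' permA chains(2,1) that])
  let ?D = "derived G (carrier G)" and ?K = "commutator_subgroup G A B"
  have D: "subgroup ?D G" by (rule derived_is_subgroup) simp
  have K: "?K \<lhd> G" by (rule commutator_subgroup_of_factors_normal[OF A B car])
  then have Ksub: "subgroup ?K G" by (rule normal_imp_subgroup)
  have KD: "?K \<subseteq> ?D"
    unfolding commutator_subgroup_self[symmetric]
    by (intro commutator_subgroup_mono subgroup.subset A B)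
  interpret D: group "G\<lparr>carrier := ?D\<rparr>" by (rule subgroup_imp_group[OF D])
  interpret K: group "G\<lparr>carrier := ?K\<rparr>" by (rule subgroup_imp_group[OF Ksub])
  have "finite (carrier (G\<lparr>carrier := ?D\<rparr>))" "finite (carrier (G\<lparr>carrier := ?K\<rparr>))"
    using fin subgroup.subset[OF D] subgroup.subset[OF Ksub] by (auto intro: finite_subset)
  then obtain m n
    where m: "residual nilpotent_group (G\<lparr>carrier := ?D\<rparr>) = lower_central (G\<lparr>carrier := ?D\<rparr>) m"
      "\<And>i. lower_central (G\<lparr>carrier := ?D\<rparr>) m \<subseteq> lower_central (G\<lparr>carrier := ?D\<rparr>) i"
    and n: "residual nilpotent_group (G\<lparr>carrier := ?K\<rparr>) = lower_central (G\<lparr>carrier := ?K\<rparr>) n"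
      "\<And>i. lower_central (G\<lparr>carrier := ?K\<rparr>) n \<subseteq> lower_central (G\<lparr>carrier := ?K\<rparr>) i"
    using D.nilpotent_residual K.nilpotent_residual by metis
  define R where "R = lower_central (G\<lparr>carrier := ?K\<rparr>) n"
  have R: "R \<lhd> G" unfolding R_def by (rule lower_central_of_normal_subgroup[OF K])
  have ssR: "supersoluble_group (G Mod R)"
    by (rule supersoluble_Mod_of_nilpotent_commutator[OF fin A B car R _ chA chB, of n])
      (simp add: R_def)
  have RD: "R \<subseteq> lower_central (G\<lparr>carrier := ?D\<rparr>) m"
    unfolding R_def using n(2)[of m] lower_central_subgroup_mono[OF Ksub D KD, of m] by blast
  have DN: "lower_central (G\<lparr>carrier := ?D\<rparr>) m \<subseteq> N"
    if "N \<lhd> G" "supersoluble_group (G Mod N)" for N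
    using supersoluble_Mod_imp_lower_central_derived_subset[OF that] m(2) by blast
  have "residual supersoluble_group G = R"
    unfolding residual_def
  proof (rule Least_equality)
    show "R \<lhd> G \<and> supersoluble_group (G Mod R)" using R ssR by blast
    show "R \<le> N" if "N \<lhd> G \<and> supersoluble_group (G Mod N)" for N
      using RD DN that by blast
  qed
  moreover have "lower_central (G\<lparr>carrier := ?D\<rparr>) m = R" using RD DN[OF R ssR] by blast
  ultimately show ?thesis using m(1) n(1) by (simp add: R_def)
qed

end
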